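(* There exists an absolute numeric constant $M>0$ with the following property. Let $(R_k)_{k\ge1}$ be a sequence in $(0,1)$ with $R_k\to 1$ as $k\to\infty$, and let $(N_k)_{k\ge1}$, $(M_k)_{k\ge1}$ be sequences of positive integers. For $k\ge1$ and $1\le j\le N_k$ let $I_{k,j}\subset\mathbb{T}$ be the open arc from $\exp\big(\tfrac{(2j-1)\pi i}{N_k}\big)$ to $\exp\big(\tfrac{(2j+1)\pi i}{N_k}\big)$ (counterclockwise), and let $\zeta_{k,l,j}\in I_{k,j}$, $l=1,\dots,M_k$, be $M_k$ distinct points. Put $$w_{k,l,j}=R_k\zeta_{k,l,j},\qquad k\ge 1,\ 1\le l\le M_k,\ 1\le j\le N_k .$$ If $N_k(1-R_k)\ge M$ for all $k$ and $$\log\frac{1}{1-R_k}=O(M_k),\qquad k\to\infty,$$ then the system of Cauchy kernels $\{k_{w_{k,l,j}}\}$, ordered lexicographically in $(k,l,j)$, is a representing system for $H^1$ and also a representing system for the disk algebra $A(\mathbb{D})$.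
   Context: $\mathbb{D}$ is the open unit disk in $\mathbb{C}$, $\mathbb{T}$ the unit circle, and $m$ the normalized Lebesgue measure on $\mathbb{T}$. The Hardy space $H^1$ consists of all functions $f$ analytic in $\mathbb{D}$ with $\|f\|_{H^1}=\sup_{0<r<1}\int_{\mathbb{T}}|f(r\zeta)|\,dm(\zeta)<\infty$. The disk algebra $A(\mathbb{D})$ is the space of all functions continuous in $\overline{\mathbb{D}}$ and analytic in $\mathbb{D}$, with the sup-norm. For $\lambda\in\mathbb{D}$ the Cauchy (Szegő) kernel is $k_\lambda(z)=\dfrac{1}{1-\bar\lambda z}$. A sequence $\{x_n\}_{n\ge 1}$ in a separable infinite-dimensional Banach space $X$ is a representing system for $X$ if for every $x\in X$ there exists a sequence of complex numbers $\{c_n\}_{n\ge1}$ (not necessarily unique) such that $x=\sum_{n\ge 1}c_nx_n$, where the sequence of partial sums of the series, taken in the given order, converges to $x$ in the norm of $X$. Lexicographic order on the triple index $(k,l,j)$: first by $k$, then by $l$, then by $j$ (so $j$ varies fastest). *)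

theory Defs
  imports "HOL-Complex_Analysis.Complex_Analysis" "HOL-Probability.Probability"
    "HOL-Library.Landau_Symbols"
begin

(* Normalized Lebesgue measure on the unit circle.  The target space is the circle itself
   rather than all of the plane, so that measurability of an integrand depends only on its
   values on the circle. *)
definition circle_measure :: "complex measure" where
  "circle_measure =
     distr (uniform_measure lborel {0..<2 * pi}) (restrict_space borel (sphere 0 1)) cis"

(* Elements of the function spaces below are represented by total functions; values
   outside the open (H^1) or closed (disk algebra) unit disk play no role. *)
definition hardy_mean :: "(complex \<Rightarrow> complex) \<Rightarrow> real \<Rightarrow> real" where
  "hardy_mean f r = (\<integral>\<zeta>. norm (f (of_real r * \<zeta>)) \<partial>circle_measure)"

definition H1_space :: "(complex \<Rightarrow> complex) set" where
  "H1_space = {f. f holomorphic_on ball 0 1 \<and> bdd_above (hardy_mean f ` {0<..<1})}"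

definition H1_norm :: "(complex \<Rightarrow> complex) \<Rightarrow> real" where
  "H1_norm f = (SUP r\<in>{0<..<1}. hardy_mean f r)"

definition disk_algebra :: "(complex \<Rightarrow> complex) set" where
  "disk_algebra = {f. continuous_on (cball 0 1) f \<and> f holomorphic_on ball 0 1}"

definition disk_norm :: "(complex \<Rightarrow> complex) \<Rightarrow> real" where
  "disk_norm f = (SUP z\<in>cball 0 1. norm (f z))"

definition szego_kernel :: "complex \<Rightarrow> complex \<Rightarrow> complex" where
  "szego_kernel w z = 1 / (1 - cnj w * z)"

(* A sequence x in the function space X with norm nrm; sequences start at index 0. *)
definition representing_system ::
  "(complex \<Rightarrow> complex) set \<Rightarrow> ((complex \<Rightarrow> complex) \<Rightarrow> real) \<Rightarrow> (nat \<Rightarrow> complex \<Rightarrow> complex) \<Rightarrow> bool"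
where
  "representing_system X nrm x \<longleftrightarrow>
     (\<forall>n. x n \<in> X) \<and>
     (\<forall>f\<in>X. \<exists>c :: nat \<Rightarrow> complex.
        (\<lambda>m. nrm (\<lambda>z. f z - (\<Sum>n<m. c n * x n z))) \<longlonglongrightarrow> 0)"

(* For n = 1 this is the circle without the point -1. *)
definition open_arc :: "nat \<Rightarrow> nat \<Rightarrow> complex set" where
  "open_arc n j =
     cis ` {(2 * real j - 1) * pi / real n <..< (2 * real j + 1) * pi / real n}"

definition triple_index :: "(nat \<Rightarrow> nat) \<Rightarrow> (nat \<Rightarrow> nat) \<Rightarrow> (nat \<times> nat \<times> nat) set" where
  "triple_index N M = {(k, l, j). 1 \<le> k \<and> l \<in> {1..M k} \<and> j \<in> {1..N k}}"

fun lex_next :: "(nat \<Rightarrow> nat) \<Rightarrow> (nat \<Rightarrow> nat) \<Rightarrow> nat \<times> nat \<times> nat \<Rightarrow> nat \<times> nat \<times> nat" where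
  "lex_next N M (k, l, j) =
     (if j < N k then (k, l, Suc j)
      else if l < M k then (k, Suc l, 1)
      else (Suc k, 1, 1))"

(* The increasing enumeration of triple_index N M in lexicographic order, for N, M positive
   on {1..}; this is verified in lex_enum_bij_betw and lex_enum_increasing. *)
definition lex_enum :: "(nat \<Rightarrow> nat) \<Rightarrow> (nat \<Rightarrow> nat) \<Rightarrow> nat \<Rightarrow> nat \<times> nat \<times> nat" where
  "lex_enum N M n = (lex_next N M ^^ n) (1, 1, 1)"

abbreviation lex_less :: "((nat \<times> nat \<times> nat) \<times> (nat \<times> nat \<times> nat)) set" where
  "lex_less \<equiv> less_than <*lex*> less_than <*lex*> less_than"

lemma lex_enum_increasing:
  assumes "m < n"
  shows "(lex_enum N M m, lex_enum N M n) \<in> lex_less"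
proof -
  have step: "(p, lex_next N M p) \<in> lex_less" for p
    by (cases p) auto
  have tr: "trans lex_less" by (intro trans_lex_prod trans_less_than)
  show ?thesis using assms
  proof (induction n)
    case (Suc n)
    have "lex_enum N M (Suc n) = lex_next N M (lex_enum N M n)"
      by (simp add: lex_enum_def)
    with step[of "lex_enum N M n"] Suc show ?case
      by (metis less_Suc_eq tr transE)
  qed simp
qed

lemma lex_enum_bij_betw:
  assumes pos: "\<And>k. k \<ge> 1 \<Longrightarrow> N k > 0 \<and> M k > 0"
  shows "bij_betw (lex_enum N M) UNIV (triple_index N M)"
proof -
  have suc: "lex_enum N M (Suc n) = lex_next N M (lex_enum N M n)" for n
    by (simp add: lex_enum_def)
  have wf: "wf lex_less" by (intro wf_lex_prod wf_less_than)
  have inj: "inj (lex_enum N M)"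
  proof (rule injI, rule ccontr)
    fix m n assume "lex_enum N M m = lex_enum N M n" "m \<noteq> n"
    then show False
      using lex_enum_increasing[of m n N M] lex_enum_increasing[of n m N M] wf_not_refl[OF wf]
      by (metis nat_neq_iff)
  qed
  have next_in: "lex_next N M p \<in> triple_index N M" if "p \<in> triple_index N M" for p
    using that pos[of "fst p"] pos[of "Suc (fst p)"]
    by (cases p) (auto simp: triple_index_def Suc_le_eq)
  have mem: "lex_enum N M n \<in> triple_index N M" for n
  proof (induction n)
    case 0 show ?case using pos[of 1] by (simp add: lex_enum_def triple_index_def Suc_le_eq)
  next
    case (Suc n) then show ?case using next_in by (simp add: suc)
  qed
  have surj: "p \<in> range (lex_enum N M)" if "p \<in> triple_index N M" for p
    using wf that
  proof (induction p rule: wf_induct_rule)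
    case (less p)
    obtain k l j where p: "p = (k, l, j)" by (cases p) auto
    have b: "1 \<le> k" "1 \<le> l" "l \<le> M k" "1 \<le> j" "j \<le> N k"
      using less.prems by (auto simp: p triple_index_def)
    show ?case
    proof (cases "p = (1, 1, 1)")
      case True
      then have "p = lex_enum N M 0" by (simp add: lex_enum_def)
      then show ?thesis by blast
    next
      case False
      have "\<exists>q \<in> triple_index N M. (q, p) \<in> lex_less \<and> lex_next N M q = p"
      proof -
        consider "j > 1" | "j = 1" "l > 1" | "j = 1" "l = 1" "k > 1"
          using b False p by fastforce
        then show ?thesis
        proof cases
          case 1
          then show ?thesis using b
            by (intro bexI[of _ "(k, l, j - 1)"]) (auto simp: p triple_index_def)
        next
          case 2
          then show ?thesis using b
            by (intro bexI[of _ "(k, l - 1, N k)"]) (auto simp: p triple_index_def)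
        next
          case 3
          then have "1 \<le> k - 1" by linarith
          with 3 show ?thesis using pos[of "k - 1"]
            by (intro bexI[of _ "(k - 1, M (k - 1), N (k - 1))"])
               (auto simp: p triple_index_def Suc_le_eq)
        qed
      qed
      then obtain q where "q \<in> triple_index N M" "(q, p) \<in> lex_less" "lex_next N M q = p"
        by blast
      moreover from this obtain n where "q = lex_enum N M n"
        using less.IH by blast
      ultimately show ?thesis using suc[of n] by (metis rangeI)
    qed
  qed
  show ?thesis unfolding bij_betw_def using inj mem surj by blast
qed

end

(* Since R_k -> 1, the dilate f(R z) approximates f in norm, and Cauchy's formula writes it as the
   integral of f(w) k_{Rw}(z) dm(w).  Replacing w by the sample point on each arc changes the kernel
   by at most O(1/N) |k_{Rw}(z)|^2, whose mean is O(1/(N (1 - R))) in either variable; so for large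
   N (1 - R) every row of kernels reproduces f up to half of its norm, both in H^1 and in the
   sup-norm.  An incomplete row only has norm O(log (1/(1 - R))), and averaging over M_k rows makes
   all partial sums of the block uniformly bounded.  Expanding the remainder greedily in later and
   later blocks gives convergence.

   That dilations converge in H^1 is proved without boundary values: a polynomial p is majorized in
   the disk, with equality of moduli on the circle, by a zero-free polynomial F = g^2; writing
   p = h g with |h| <= |g|, the orthogonality of powers bounds the mean of |p(z) - p(sz)| by the
   increase of the means of |p|. *)

theory Submission
  imports Defs
begin

subsection \<open>Means over the unit circle\<close>

text \<open>An element of H^1 comes without boundary values here, so the coefficients are taken from
  f(rz) with a fixed r < 1, which is continuous on the closed disk; all estimates of a row are kept
  in terms of the norm of f, uniformly in r. The difficulty lies between the ends of the blocks:
  cutting a row destroys the cancellation in Cauchy's formula, and only the mean of |k| remains.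
  Small weights are the remedy. They depend on the arcs but not on the sample points, so the rows of
  a block can share them after division by M_k; at any position at most one row is cut, and the
  growth of M_k pays for it. Both norms obey the same bounds because |k_{sa}(b)| = |k_{sb}(a)| for
  real s: a kernel mean over the parameter, as the sup-norm requires, equals one over the variable,
  as H^1 requires. How late a block must be to reduce the remainder depends on that remainder,
  through its continuity after dilation; blocks passed over in the meantime receive zero
  coefficients.\<close>

definition circle_mean :: "(complex \<Rightarrow> 'a::banach) \<Rightarrow> 'a" where
  "circle_mean \<phi> = integral {0..1} (\<lambda>t. \<phi> (cis (2 * pi * t)))"

lemma continuous_on_cis_comp:
  fixes \<phi> :: "complex \<Rightarrow> 'a::topological_space"
  assumes "continuous_on (sphere 0 1) \<phi>"
  shows "continuous_on A (\<lambda>t. \<phi> (cis (2 * pi * t)))"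
proof -
  have "continuous_on A (\<lambda>t::real. cis (2 * pi * t))"
    by (intro continuous_intros)
  then have "continuous_on A (\<phi> \<circ> (\<lambda>t. cis (2 * pi * t)))"
    by (intro continuous_on_compose continuous_on_subset[OF assms]) auto
  then show ?thesis by (simp add: o_def)
qed

lemma integrable_cis_comp:
  fixes \<phi> :: "complex \<Rightarrow> 'a::banach"
  assumes "continuous_on (sphere 0 1) \<phi>"
  shows "(\<lambda>t. \<phi> (cis (2 * pi * t))) integrable_on {a..b}"
  by (rule integrable_continuous_interval[OF continuous_on_cis_comp[OF assms]])

lemma circle_mean_cong:
  assumes "\<And>z. norm z = 1 \<Longrightarrow> \<phi> z = \<psi> z"
  shows "circle_mean \<phi> = circle_mean \<psi>"
  unfolding circle_mean_def by (rule integral_cong) (simp add: assms)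

lemma circle_mean_const [simp]: "circle_mean (\<lambda>_. c) = c"
  by (simp add: circle_mean_def)

lemma circle_mean_add:
  fixes \<phi> \<psi> :: "complex \<Rightarrow> 'a::banach"
  assumes "continuous_on (sphere 0 1) \<phi>" "continuous_on (sphere 0 1) \<psi>"
  shows "circle_mean (\<lambda>z. \<phi> z + \<psi> z) = circle_mean \<phi> + circle_mean \<psi>"
  unfolding circle_mean_def
  by (rule integral_add) (rule integrable_cis_comp, fact assms)+

lemma circle_mean_sum:
  fixes \<phi> :: "'i \<Rightarrow> complex \<Rightarrow> 'a::banach"
  assumes "\<And>i. i \<in> I \<Longrightarrow> continuous_on (sphere 0 1) (\<phi> i)" "finite I"
  shows "circle_mean (\<lambda>z. \<Sum>i\<in>I. \<phi> i z) = (\<Sum>i\<in>I. circle_mean (\<phi> i))"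
  unfolding circle_mean_def
  using assms by (subst integral_sum) (auto intro: integrable_cis_comp)

lemma circle_mean_mult_left:
  fixes \<phi> :: "complex \<Rightarrow> 'a::{real_normed_field,banach}"
  shows "circle_mean (\<lambda>z. c * \<phi> z) = c * circle_mean \<phi>"
  unfolding circle_mean_def by simp

lemma circle_mean_mono:
  fixes \<phi> \<psi> :: "complex \<Rightarrow> real"
  assumes "continuous_on (sphere 0 1) \<phi>" "continuous_on (sphere 0 1) \<psi>"
    "\<And>z. norm z = 1 \<Longrightarrow> \<phi> z \<le> \<psi> z"
  shows "circle_mean \<phi> \<le> circle_mean \<psi>"
  unfolding circle_mean_def
  by (rule integral_le) (rule integrable_cis_comp, fact assms | simp add: assms)+

lemma circle_mean_nonneg:
  fixes \<phi> :: "complex \<Rightarrow> real"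
  assumes "continuous_on (sphere 0 1) \<phi>" "\<And>z. norm z = 1 \<Longrightarrow> 0 \<le> \<phi> z"
  shows "0 \<le> circle_mean \<phi>"
  unfolding circle_mean_def
  by (rule integral_nonneg) (rule integrable_cis_comp, fact assms | simp add: assms)+

lemma circle_mean_of_real:
  fixes \<phi> :: "complex \<Rightarrow> real"
  assumes "continuous_on (sphere 0 1) \<phi>"
  shows "circle_mean (\<lambda>z. complex_of_real (\<phi> z)) = of_real (circle_mean \<phi>)"
proof -
  have "((\<lambda>t. \<phi> (cis (2 * pi * t))) has_integral circle_mean \<phi>) {0..1}"
    unfolding circle_mean_def using integrable_cis_comp[OF assms] by (rule integrable_integral)
  from has_integral_linear[OF this bounded_linear_of_real[where 'a=complex]] show ?thesis
    unfolding circle_mean_def o_def by (simp add: integral_unique)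
qed

lemma circle_mean_uniform_limit:
  fixes \<phi> :: "nat \<Rightarrow> complex \<Rightarrow> 'a::banach"
  assumes u: "uniform_limit (sphere 0 1) \<phi> \<psi> sequentially"
    and c: "\<And>n. continuous_on (sphere 0 1) (\<phi> n)"
  shows "(\<lambda>n. circle_mean (\<phi> n)) \<longlonglongrightarrow> circle_mean \<psi>"
proof -
  have "uniform_limit {0..1::real} (\<lambda>n t. \<phi> n (cis (2 * pi * t))) (\<lambda>t. \<psi> (cis (2 * pi * t))) sequentially"
    by (rule uniform_limit_compose'[OF u]) auto
  then obtain I J where IJ: "\<And>n. ((\<lambda>t. \<phi> n (cis (2 * pi * t))) has_integral I n) {0..1::real}"
    "((\<lambda>t. \<psi> (cis (2 * pi * t))) has_integral J) {0..1::real}" "I \<longlonglongrightarrow> J"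
    by (rule uniform_limit_integral[OF _ continuous_on_cis_comp[OF c]]) auto
  then have "circle_mean (\<phi> n) = I n" "circle_mean \<psi> = J" for n
    by (auto simp: circle_mean_def integral_unique)
  with IJ(3) show ?thesis by simp
qed

lemma circle_mean_swap:
  fixes \<Phi> :: "complex \<Rightarrow> complex \<Rightarrow> 'a::banach"
  assumes "continuous_on (sphere 0 1 \<times> sphere 0 1) (\<lambda>(z, w). \<Phi> z w)"
  shows "circle_mean (\<lambda>z. circle_mean (\<Phi> z)) = circle_mean (\<lambda>w. circle_mean (\<lambda>z. \<Phi> z w))"
proof -
  have "continuous_on A (\<lambda>p::real\<times>real. (cis (2 * pi * fst p), cis (2 * pi * snd p)))" for A
    by (intro continuous_intros)
  then have "continuous_on A ((\<lambda>(z, w). \<Phi> z w) \<circ> (\<lambda>p::real\<times>real. (cis (2 * pi * fst p), cis (2 * pi * snd p))))" for A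
    by (intro continuous_on_compose continuous_on_subset[OF assms]) auto
  then have "continuous_on (cbox (0, 0) (1, 1)) (\<lambda>(s::real, t::real). \<Phi> (cis (2 * pi * s)) (cis (2 * pi * t)))"
    by (simp add: o_def case_prod_beta)
  from integral_swap_continuous[OF this] show ?thesis
    unfolding circle_mean_def by simp
qed

text \<open>For z = cis (2 pi t) one has dz / z = 2 pi i dt; this is the bridge to contour
  integration.\<close>

lemma circle_mean_contour:
  "contour_integral (circlepath 0 1) (\<lambda>z. \<phi> z / z) = 2 * of_real pi * \<i> * circle_mean \<phi>"
proof -
  have e: "exp (2 * complex_of_real pi * \<i> * complex_of_real x) = cis (2 * pi * x)" for x
    by (simp add: cis_conv_exp mult_ac)
  have circle: "circlepath 0 1 x = cis (2 * pi * x)" for x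
    by (simp add: circlepath e)
  have "contour_integral (circlepath 0 1) (\<lambda>z. \<phi> z / z) =
    integral {0..1} (\<lambda>t. 2 * of_real pi * \<i> * \<phi> (cis (2 * pi * t)))"
    unfolding contour_integral_integral vector_derivative_circlepath e
    by (rule integral_cong) (simp add: circle)
  then show ?thesis by (simp add: circle_mean_def)
qed

text \<open>On the circle 1 / z = \<open>cnj z\<close>, which turns the Cauchy kernel into the value
  at \<open>w\<close> of the Szego kernel with parameter \<open>z\<close>. So f is a continuous
  superposition of kernels; this is the integral that gets discretized.\<close>

lemma circle_mean_Cauchy:
  assumes "continuous_on (cball 0 1) f" "f holomorphic_on ball 0 1" "norm w < 1"
  shows "circle_mean (\<lambda>z. f z / (1 - cnj z * w)) = f w"
proof -
  have "2 * of_real pi * \<i> * f w = contour_integral (circlepath 0 1) (\<lambda>u. f u / (u - w))"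
    using Cauchy_integral_circlepath[OF assms(1,2), of w] assms(3)
    by (simp add: contour_integral_unique)
  also have "\<dots> = contour_integral (circlepath 0 1) (\<lambda>z. (z * f z / (z - w)) / z)"
    by (rule contour_integral_cong) auto
  also have "\<dots> = 2 * of_real pi * \<i> * circle_mean (\<lambda>z. z * f z / (z - w))"
    by (rule circle_mean_contour)
  also have "circle_mean (\<lambda>z. z * f z / (z - w)) = circle_mean (\<lambda>z. f z / (1 - cnj z * w))"
  proof (rule circle_mean_cong)
    fix z :: complex assume z: "norm z = 1"
    then have "z * cnj z = 1" by (simp add: complex_norm_square[symmetric])
    then have "z - w = z * (1 - cnj z * w)" by (simp add: algebra_simps flip: mult.assoc)
    moreover have "z \<noteq> 0" using z by auto
    ultimately show "z * f z / (z - w) = f z / (1 - cnj z * w)" by simp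
  qed
  finally show ?thesis by simp
qed

text \<open>Links the Lebesgue integral behind \<open>hardy_mean\<close> to the gauge integral over
  one period, in which uniform limits, exchange of integrals and contour integrals are
  expressed.\<close>

lemma integral_circle_measure:
  fixes \<phi> :: "complex \<Rightarrow> real"
  assumes "continuous_on (sphere 0 1) \<phi>"
  shows "(\<integral>z. \<phi> z \<partial>circle_measure) = circle_mean \<phi>"
proof -
  have meas: "\<phi> \<in> borel_measurable (restrict_space borel (sphere 0 1))"
    using assms by (rule borel_measurable_continuous_on_restrict)
  have cis: "cis \<in> borel \<rightarrow>\<^sub>M restrict_space borel (sphere 0 1)"
    by (intro measurable_restrict_space2 borel_measurable_continuous_onI continuous_intros) auto
  then have cis': "cis \<in> uniform_measure lborel {0..<2 * pi} \<rightarrow>\<^sub>M restrict_space borel (sphere 0 1)"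
    by simp
  have bm: "(\<lambda>t. \<phi> (cis t)) \<in> borel_measurable borel"
    using measurable_comp[OF cis meas] by (simp add: o_def)
  have cont: "continuous_on A (\<lambda>t. \<phi> (cis t))" for A
    by (rule continuous_on_compose2[OF assms]) (auto intro!: continuous_intros)
  have "(\<integral>z. \<phi> z \<partial>circle_measure) = (\<integral>t. \<phi> (cis t) \<partial>uniform_measure lborel {0..<2 * pi})"
    unfolding circle_measure_def by (rule integral_distr[OF cis' meas])
  also have "\<dots> = (\<integral>t. (indicator {0..<2 * pi} t / (2 * pi)) *\<^sub>R \<phi> (cis t) \<partial>lborel)"
  proof -
    have "1 / ennreal (2 * pi) = ennreal (1 / (2 * pi))"
      using divide_ennreal[of 1 "2 * pi"] by simp
    then have "indicator {0..<2 * pi} t / emeasure lborel {0..<2 * pi} = ennreal (indicator {0..<2 * pi} t / (2 * pi))" for t :: real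
      by (cases "t \<in> {0..<2 * pi}") simp_all
    then have "uniform_measure lborel {0..<2 * pi} = density lborel (\<lambda>t. ennreal (indicator {0..<2 * pi} t / (2 * pi)))"
      unfolding uniform_measure_def by simp
    then have "(\<integral>t. \<phi> (cis t) \<partial>uniform_measure lborel {0..<2 * pi}) =
      (\<integral>t. \<phi> (cis t) \<partial>density lborel (\<lambda>t. ennreal (indicator {0..<2 * pi} t / (2 * pi))))"
      by (rule arg_cong)
    also have "\<dots> = (\<integral>t. (indicator {0..<2 * pi} t / (2 * pi)) *\<^sub>R \<phi> (cis t) \<partial>lborel)"
      by (rule integral_density) (use bm in \<open>auto split: split_indicator\<close>)
    finally show ?thesis .
  qed
  \<comment> \<open>The added endpoint is a null set; on the closed interval continuity gives
    integrability.\<close>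
  also have "\<dots> = (\<integral>t. (indicator {0..2 * pi} t * \<phi> (cis t)) / (2 * pi) \<partial>lborel)"
  proof (rule integral_cong_AE)
    show "AE t in lborel. (indicator {0..<2 * pi} t / (2 * pi)) *\<^sub>R \<phi> (cis t) = (indicator {0..2 * pi} t * \<phi> (cis t)) / (2 * pi)"
      using AE_lborel_singleton[of "2 * pi"] by eventually_elim (auto split: split_indicator)
  qed (use bm in measurable)
  also have "\<dots> = (LINT t:{0..2 * pi}|lborel. \<phi> (cis t)) / (2 * pi)"
    by (simp add: set_lebesgue_integral_def)
  also have "(LINT t:{0..2 * pi}|lborel. \<phi> (cis t)) = integral {0..2 * pi} (\<lambda>t. \<phi> (cis t))"
    by (intro set_borel_integral_eq_integral borel_integrable_atLeastAtMost' cont)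
  also have "integral {0..2 * pi} (\<lambda>t. \<phi> (cis t)) / (2 * pi) = circle_mean \<phi>"
  proof -
    have im: "(\<lambda>x. x / (2 * pi)) ` {0..2 * pi} = {0..1}"
    proof
      show "{0..1} \<subseteq> (\<lambda>x. x / (2 * pi)) ` {0..2 * pi}"
      proof
        fix x :: real assume "x \<in> {0..1}"
        then show "x \<in> (\<lambda>x. x / (2 * pi)) ` {0..2 * pi}"
          by (intro image_eqI[of _ _ "2 * pi * x"]) (auto simp: mult_left_le)
      qed
    qed auto
    show ?thesis
      using integral_stretch_real[of "2 * pi" 0 "2 * pi" "\<lambda>t. \<phi> (cis t)"]
      by (simp add: im circle_mean_def)
  qed
  finally show ?thesis .
qed

lemma hardy_mean_eq_circle_mean:
  assumes "continuous_on (sphere 0 \<bar>r\<bar>) f"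
  shows "hardy_mean f r = circle_mean (\<lambda>z. norm (f (of_real r * z)))"
  unfolding hardy_mean_def
proof (rule integral_circle_measure)
  have "continuous_on (sphere 0 1) (f \<circ> (\<lambda>z. of_real r * z))"
    by (intro continuous_on_compose continuous_on_subset[OF assms] continuous_intros)
      (auto simp: norm_mult)
  then show "continuous_on (sphere 0 1) (\<lambda>z. norm (f (of_real r * z)))"
    by (auto simp: o_def intro!: continuous_intros)
qed

subsection \<open>Szego kernels\<close>

lemma szego_denominator_ge:
  assumes "norm z \<le> 1"
  shows "1 - norm w \<le> norm (1 - cnj w * z)"
proof -
  have "norm (cnj w * z) \<le> norm w"
    using assms by (simp add: norm_mult mult_left_le)
  then show ?thesis
    using norm_triangle_ineq2[of 1 "cnj w * z"] by simp
qed

lemma szego_denominator_nonzero: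
  assumes "norm w < 1" "norm z \<le> 1"
  shows "1 - cnj w * z \<noteq> 0"
proof
  assume "1 - cnj w * z = 0"
  with szego_denominator_ge[OF assms(2), of w] assms(1) show False by simp
qed

lemma holomorphic_szego_kernel:
  assumes "norm w < 1"
  shows "szego_kernel w holomorphic_on cball 0 1"
  unfolding szego_kernel_def[abs_def]
  by (intro holomorphic_intros) (use szego_denominator_nonzero[OF assms] in auto)

lemma continuous_on_szego_kernel:
  assumes "norm w < 1" "A \<subseteq> cball 0 1"
  shows "continuous_on A (szego_kernel w)"
  using holomorphic_szego_kernel[OF assms(1)] assms(2) continuous_on_subset
    holomorphic_on_imp_continuous_on by blast

lemma norm_szego_kernel_le:
  assumes "norm w < 1" "norm z \<le> 1"
  shows "norm (szego_kernel w z) \<le> 1 / (1 - norm w)"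
  using szego_denominator_ge[OF assms(2), of w] assms(1)
  by (simp add: szego_kernel_def norm_divide frac_le)

text \<open>The resolvent identity. It produces a product of two kernels, so moving the parameter
  costs a mean of |k|^2 rather than of |k|.\<close>

lemma szego_kernel_diff:
  assumes "norm a < 1" "norm b < 1" "norm z \<le> 1"
  shows "szego_kernel a z - szego_kernel b z = cnj (a - b) * z * szego_kernel a z * szego_kernel b z"
  using szego_denominator_nonzero[OF assms(1,3)] szego_denominator_nonzero[OF assms(2,3)]
  by (simp add: szego_kernel_def field_simps)

lemma norm_szego_kernel_diff_le:
  assumes "norm a < 1" "norm b < 1" "norm z \<le> 1"
  shows "norm (szego_kernel a z - szego_kernel b z)
    \<le> norm (a - b) * (norm (szego_kernel a z) * norm (szego_kernel b z))"
proof -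
  have "norm (szego_kernel a z - szego_kernel b z) =
      norm z * (norm (a - b) * (norm (szego_kernel a z) * norm (szego_kernel b z)))"
    unfolding szego_kernel_diff[OF assms] norm_mult complex_mod_cnj by (simp only: mult_ac)
  also have "\<dots> \<le> 1 * (norm (a - b) * (norm (szego_kernel a z) * norm (szego_kernel b z)))"
    using assms(3) by (intro mult_right_mono) auto
  finally show ?thesis by simp
qed

text \<open>The two denominators are complex conjugates of each other. Means over the parameter
  thereby reduce to means over the variable.\<close>

lemma norm_szego_kernel_swap:
  "norm (szego_kernel (of_real s * a) b) = norm (szego_kernel (of_real s * b) a)"
proof -
  have "1 - cnj (of_real s * a) * b = cnj (1 - cnj (of_real s * b) * a)"
    by simp
  then have "norm (1 - cnj (of_real s * a) * b) = norm (1 - cnj (of_real s * b) * a)"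
    by (metis complex_mod_cnj)
  then show ?thesis by (simp add: szego_kernel_def norm_divide)
qed

lemma szego_kernel_dilate:
  "szego_kernel a (of_real r * z) = szego_kernel (of_real r * a) z"
  by (simp add: szego_kernel_def mult_ac)

text \<open>The reproducing property: |k_w|^2 is k_w times its conjugate, and the conjugate is the
  kernel in Cauchy's formula at \<open>w\<close>, so the mean is k_w(w).\<close>

lemma circle_mean_szego_kernel_square:
  assumes "norm w < 1"
  shows "circle_mean (\<lambda>z. (norm (szego_kernel w z))\<^sup>2) = 1 / (1 - (norm w)\<^sup>2)"
proof -
  have cont: "continuous_on (sphere 0 1) (\<lambda>z. (norm (szego_kernel w z))\<^sup>2)"
    by (intro continuous_intros continuous_on_szego_kernel assms) auto
  have "complex_of_real (circle_mean (\<lambda>z. (norm (szego_kernel w z))\<^sup>2)) =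
      circle_mean (\<lambda>z. complex_of_real ((norm (szego_kernel w z))\<^sup>2))"
    using circle_mean_of_real[OF cont] by simp
  also have "\<dots> = circle_mean (\<lambda>z. szego_kernel w z / (1 - cnj z * w))"
  proof (rule circle_mean_cong)
    fix z :: complex
    have "complex_of_real ((norm (szego_kernel w z))\<^sup>2) = szego_kernel w z * cnj (szego_kernel w z)"
      by (rule complex_norm_square)
    then show "complex_of_real ((norm (szego_kernel w z))\<^sup>2) = szego_kernel w z / (1 - cnj z * w)"
      by (simp add: szego_kernel_def mult.commute)
  qed
  also have "\<dots> = szego_kernel w w"
    using holomorphic_szego_kernel[OF assms] assms
    by (intro circle_mean_Cauchy continuous_on_szego_kernel) (auto intro: holomorphic_on_subset)
  also have "\<dots> = of_real (1 / (1 - (norm w)\<^sup>2))"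
    using complex_norm_square[of w] by (simp add: szego_kernel_def mult.commute)
  finally show ?thesis unfolding of_real_eq_iff .
qed

lemma circle_mean_szego_kernel_square_le:
  assumes "norm w \<le> R" "R < 1"
  shows "circle_mean (\<lambda>z. (norm (szego_kernel w z))\<^sup>2) \<le> 1 / (1 - R)"
proof -
  have "(norm w)\<^sup>2 \<le> norm w * 1"
    unfolding power2_eq_square using assms by (intro mult_left_mono) auto
  with assms show ?thesis
    by (subst circle_mean_szego_kernel_square) (auto intro!: frac_le)
qed

text \<open>Halving \<open>1 - norm w\<close> costs at most an additive constant, whence a logarithmic bound.\<close>

lemma circle_mean_szego_kernel_le:
  assumes "norm w < 1" "(1 / 2) ^ n \<le> 1 - norm w"
  shows "circle_mean (\<lambda>z. norm (szego_kernel w z)) \<le> 1 + real n"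
  using assms
proof (induction n arbitrary: w)
  case 0
  then have "w = 0" by simp
  then show ?case by (simp add: szego_kernel_def)
next
  case (Suc n)
  have cont: "continuous_on (sphere 0 1) (\<lambda>z. norm (szego_kernel v z))" if "norm v < 1" for v
    by (intro continuous_intros continuous_on_szego_kernel that) auto
  show ?case
  proof (cases "norm w \<le> 1 / 2")
    case True
    \<comment> \<open>Doubling 1 - |w| is impossible inside the disk when |w| < 1/2, but there the
      kernel is at most 2, which is within \<open>1 + real (Suc n)\<close>.\<close>
    have "circle_mean (\<lambda>z. norm (szego_kernel w z)) \<le> circle_mean (\<lambda>_. 2)"
    proof (intro circle_mean_mono cont continuous_intros)
      fix z :: complex assume "norm z = 1"
      then have "norm (szego_kernel w z) \<le> 1 / (1 - norm w)"
        using Suc.prems by (intro norm_szego_kernel_le) auto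
      also have "\<dots> \<le> 1 / (1 / 2)"
        using True by (intro divide_left_mono) auto
      finally show "norm (szego_kernel w z) \<le> 2" by simp
    qed (use Suc.prems in auto)
    then show ?thesis by simp
  next
    case False
    \<comment> \<open>The point on the same radius with 1 - |v| = 2 (1 - |w|); hence |w - v| = 1 -
      |w|.\<close>
    define v where "v = of_real ((2 * norm w - 1) / norm w) * w"
    have w0: "complex_of_real (norm w) \<noteq> 0" using False by auto
    have "0 \<le> (2 * norm w - 1) / norm w"
      using False by simp
    then have "norm v = (2 * norm w - 1) / norm w * norm w"
      unfolding v_def norm_mult norm_of_real by (simp only: abs_of_nonneg)
    then have nv: "norm v = 2 * norm w - 1"
      using w0 by simp
    then have v1: "norm v < 1" using Suc.prems(1) by simp
    have "w - v = of_real ((1 - norm w) / norm w) * w"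
      using w0 by (simp add: v_def field_simps)
    then have "norm (w - v) = \<bar>(1 - norm w) / norm w\<bar> * norm w"
      by (simp only: norm_mult norm_of_real)
    moreover have "0 \<le> (1 - norm w) / norm w"
      using Suc.prems(1) by simp
    ultimately have d: "norm (w - v) = 1 - norm w"
      using w0 Suc.prems(1) by simp
    have IH: "circle_mean (\<lambda>z. norm (szego_kernel v z)) \<le> 1 + real n"
      using Suc.prems v1 nv by (intro Suc.IH) auto
    let ?k = "\<lambda>u z. (norm (szego_kernel u z))\<^sup>2"
    have cont2: "continuous_on (sphere 0 1) (?k u)" if "norm u < 1" for u
      using continuous_on_power[OF cont[OF that]] .
    have pt: "norm (szego_kernel w z) \<le> norm (szego_kernel v z) +
        ((1 - norm w) / 2) * (?k w z + ?k v z)" if "norm z = 1" for z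
    proof -
      have "norm (szego_kernel w z - szego_kernel v z)
          \<le> (1 - norm w) * (norm (szego_kernel w z) * norm (szego_kernel v z))"
        using norm_szego_kernel_diff_le[of w v z] Suc.prems(1) v1 that d by simp
      \<comment> \<open>The product of kernels is split into squares, whose means are known
        exactly.\<close>
      also have "\<dots> \<le> (1 - norm w) * ((?k w z + ?k v z) / 2)"
        using Suc.prems(1) sum_squares_bound[of "norm (szego_kernel w z)" "norm (szego_kernel v z)"]
        by (intro mult_left_mono) auto
      finally show ?thesis
        using norm_triangle_ineq2[of "szego_kernel w z" "szego_kernel v z"] by simp
    qed
    have "circle_mean (\<lambda>z. norm (szego_kernel w z)) \<le>
        circle_mean (\<lambda>z. norm (szego_kernel v z) + ((1 - norm w) / 2) * (?k w z + ?k v z))"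
      using Suc.prems(1) v1 pt by (intro circle_mean_mono continuous_intros cont cont2)
    also have "\<dots> = circle_mean (\<lambda>z. norm (szego_kernel v z)) +
        (1 - norm w) / 2 * (circle_mean (?k w) + circle_mean (?k v))"
      using Suc.prems(1) v1
      by (simp only: circle_mean_add circle_mean_mult_left cont cont2
          continuous_on_add continuous_on_mult_left)
    \<comment> \<open>Since |v| \<le> |w|, both square means are at most 1 / (1 - |w|), so one
      halving costs exactly 1.\<close>
    also have "\<dots> \<le> (1 + real n) + (1 - norm w) / 2 * (1 / (1 - norm w) + 1 / (1 - norm w))"
      using Suc.prems(1) IH nv
      by (intro add_mono mult_left_mono circle_mean_szego_kernel_square_le) auto
    also have "\<dots> = 1 + real (Suc n)"
      using Suc.prems(1) by (simp add: field_simps)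
    finally show ?thesis .
  qed
qed

subsection \<open>Dilations\<close>

lemma uniform_limit_dilation:
  fixes \<phi> :: "complex \<Rightarrow> 'a::metric_space"
  assumes \<phi>: "continuous_on (cball 0 1) \<phi>" and s: "s \<longlonglongrightarrow> 1"
    and s01: "\<forall>\<^sub>F n in sequentially. \<bar>s n\<bar> \<le> 1"
  shows "uniform_limit (cball 0 1) (\<lambda>n z. \<phi> (of_real (s n) * z)) \<phi> sequentially"
proof (rule uniform_limit_compose_uniformly_continuous_on[where g' = "\<lambda>z. z"])
  show "uniform_limit (cball 0 1) (\<lambda>n z. of_real (s n) * z) (\<lambda>z::complex. z) sequentially"
  proof (rule uniform_limitI)
    fix e :: real assume "e > 0"
    with s have "\<forall>\<^sub>F n in sequentially. dist (s n) 1 < e" by (rule tendstoD)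
    then show "\<forall>\<^sub>F n in sequentially. \<forall>z\<in>cball 0 1. dist (of_real (s n) * z) (z::complex) < e"
    proof eventually_elim
      case (elim n)
      show ?case
      proof
        fix z :: complex assume "z \<in> cball 0 1"
        have "of_real (s n) * z - z = of_real (s n - 1) * z" by (simp add: algebra_simps)
        then have "dist (of_real (s n) * z) z = \<bar>s n - 1\<bar> * norm z"
          by (simp only: dist_norm norm_mult norm_of_real)
        also have "\<dots> \<le> \<bar>s n - 1\<bar>" using \<open>z \<in> cball 0 1\<close> by (simp add: mult_left_le)
        finally show "dist (of_real (s n) * z) z < e" using elim by (simp add: dist_real_def)
      qed
    qed
  qed
  show "uniformly_continuous_on (cball 0 1) \<phi>"
    by (intro compact_uniformly_continuous \<phi>) simp
  show "\<forall>\<^sub>F n in sequentially. \<forall>z\<in>cball 0 1. of_real (s n) * z \<in> cball (0::complex) 1"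
    using s01 by eventually_elim (auto simp: norm_mult mult_le_one)
qed simp

lemma continuous_on_dilate:
  fixes f :: "complex \<Rightarrow> 'a::topological_space"
  assumes "continuous_on (ball 0 1) f" "\<bar>r\<bar> < 1" "A \<subseteq> cball 0 1"
  shows "continuous_on A (\<lambda>z. f (of_real r * z))"
proof (rule continuous_on_compose2[OF assms(1)])
  show "(\<lambda>z. complex_of_real r * z) ` A \<subseteq> ball 0 1"
  proof safe
    fix z assume "z \<in> A"
    then have "norm z \<le> 1" using assms(3) by auto
    then have "\<bar>r\<bar> * norm z \<le> \<bar>r\<bar>" by (simp add: mult_left_le)
    then show "of_real r * z \<in> ball 0 1" using assms(2) by (simp add: norm_mult)
  qed
qed (intro continuous_intros)

lemma circle_mean_norm_limit:
  fixes u :: "nat \<Rightarrow> complex \<Rightarrow> complex"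
  assumes "uniform_limit (sphere 0 1) u v sequentially" "\<And>n. continuous_on (sphere 0 1) (u n)"
  shows "(\<lambda>n. circle_mean (\<lambda>z. norm (u n z))) \<longlonglongrightarrow> circle_mean (\<lambda>z. norm (v z))"
    and "(\<lambda>n. circle_mean (\<lambda>z. (norm (u n z))\<^sup>2)) \<longlonglongrightarrow> circle_mean (\<lambda>z. (norm (v z))\<^sup>2)"
proof -
  have n: "uniform_limit (sphere 0 1) (\<lambda>n z. norm (u n z)) (\<lambda>z. norm (v z)) sequentially"
    by (rule uniform_limit_norm[OF assms(1)])
  then show "(\<lambda>n. circle_mean (\<lambda>z. norm (u n z))) \<longlonglongrightarrow> circle_mean (\<lambda>z. norm (v z))"
    by (rule circle_mean_uniform_limit) (intro continuous_intros assms)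
  have "continuous_on (sphere 0 1) v"
    using assms by (intro uniform_limit_theorem[OF _ assms(1)]) auto
  then have "bounded ((\<lambda>z. norm (v z)) ` sphere 0 1)"
    by (intro compact_imp_bounded compact_continuous_image continuous_intros) auto
  with n have "uniform_limit (sphere 0 1) (\<lambda>n z. norm (u n z) * norm (u n z))
      (\<lambda>z. norm (v z) * norm (v z)) sequentially"
    by (intro uniform_lim_mult) auto
  then show "(\<lambda>n. circle_mean (\<lambda>z. (norm (u n z))\<^sup>2)) \<longlonglongrightarrow> circle_mean (\<lambda>z. (norm (v z))\<^sup>2)"
    unfolding power2_eq_square
    by (rule circle_mean_uniform_limit) (intro continuous_intros assms)
qed

subsection \<open>Square means\<close>

text \<open>On the circle the integrand is a positive power of z, and its mean is the value at 0.
  The denominator \<open>1 - cnj z * 0\<close> only brings it into the form of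
  \<open>circle_mean_Cauchy\<close>.\<close>

lemma circle_mean_power_cnj_power:
  assumes "i < n"
  shows "circle_mean (\<lambda>z. z ^ n * cnj (z ^ i)) = 0"
proof -
  have "circle_mean (\<lambda>z. z ^ n * cnj (z ^ i)) = circle_mean (\<lambda>z. z ^ (n - i) / (1 - cnj z * 0))"
  proof (rule circle_mean_cong)
    fix z :: complex assume "norm z = 1"
    then have "z ^ i * cnj (z ^ i) = 1"
      by (metis complex_norm_square norm_power of_real_1 power_one)
    moreover have "z ^ n = z ^ (n - i) * z ^ i"
      using assms by (simp flip: power_add)
    ultimately show "z ^ n * cnj (z ^ i) = z ^ (n - i) / (1 - cnj z * 0)"
      by (simp add: mult.assoc)
  qed
  also have "\<dots> = 0 ^ (n - i)"
    by (intro circle_mean_Cauchy continuous_intros holomorphic_intros) auto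
  finally show ?thesis using assms by simp
qed

lemma circle_mean_Re:
  assumes "continuous_on (sphere 0 1) \<phi>"
  shows "circle_mean (\<lambda>z. Re (\<phi> z)) = Re (circle_mean \<phi>)"
proof -
  have "((\<lambda>t. \<phi> (cis (2 * pi * t))) has_integral circle_mean \<phi>) {0..1}"
    unfolding circle_mean_def using integrable_cis_comp[OF assms] by (rule integrable_integral)
  from has_integral_linear[OF this bounded_linear_Re] show ?thesis
    unfolding circle_mean_def o_def by (simp add: integral_unique)
qed

text \<open>Passing from n to n + 1 terms creates the cross term \<open>?X\<close>, a combination of
  products of z^n with conjugates of lower powers, each of mean zero.\<close>

lemma circle_mean_parseval:
  "circle_mean (\<lambda>z. (norm (\<Sum>i<n. c i * z ^ i))\<^sup>2) = (\<Sum>i<n. (norm (c i))\<^sup>2)"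
proof (induction n)
  case (Suc n)
  let ?S = "\<lambda>z. \<Sum>i<n. c i * z ^ i"
  let ?X = "\<lambda>z. (c n * z ^ n) * cnj (?S z)"
  have cX: "continuous_on (sphere 0 1) ?X" and cS: "continuous_on (sphere 0 1) (\<lambda>z. (norm (?S z))\<^sup>2)"
    by (intro continuous_intros)+
  have "circle_mean ?X = circle_mean (\<lambda>z. \<Sum>i<n. (c n * cnj (c i)) * (z ^ n * cnj (z ^ i)))"
    by (intro arg_cong[of _ _ circle_mean]) (auto simp: sum_distrib_left mult_ac)
  also have "\<dots> = (\<Sum>i<n. circle_mean (\<lambda>z. (c n * cnj (c i)) * (z ^ n * cnj (z ^ i))))"
    by (intro circle_mean_sum continuous_intros) auto
  also have "\<dots> = 0"
    unfolding circle_mean_mult_left by (intro sum.neutral) (use circle_mean_power_cnj_power in simp)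
  finally have X: "circle_mean (\<lambda>z. Re (?X z)) = 0"
    using circle_mean_Re[OF cX] by simp
  have "circle_mean (\<lambda>z. (norm (\<Sum>i<Suc n. c i * z ^ i))\<^sup>2) =
      circle_mean (\<lambda>z. (norm (?S z))\<^sup>2 + (2 * Re (?X z) + (norm (c n))\<^sup>2))"
  proof (rule circle_mean_cong)
    fix z :: complex assume "norm z = 1"
    then have n: "norm (c n * z ^ n) = norm (c n)"
      by (simp add: norm_mult norm_power)
    have "(norm (A + B))\<^sup>2 = (norm A)\<^sup>2 + (2 * Re (B * cnj A) + (norm B)\<^sup>2)" for A B :: complex
      unfolding cmod_power2 by (simp add: power2_eq_square algebra_simps)
    from this[of "?S z" "c n * z ^ n"]
    show "(norm (\<Sum>i<Suc n. c i * z ^ i))\<^sup>2 = (norm (?S z))\<^sup>2 + (2 * Re (?X z) + (norm (c n))\<^sup>2)"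
      by (simp only: n sum.lessThan_Suc)
  qed
  also have "\<dots> = circle_mean (\<lambda>z. (norm (?S z))\<^sup>2) + (2 * circle_mean (\<lambda>z. Re (?X z)) + (norm (c n))\<^sup>2)"
    by (simp only: circle_mean_add circle_mean_mult_left circle_mean_const cS continuous_on_Re[OF cX]
        continuous_on_add continuous_on_mult_left continuous_on_const)
  finally show ?case by (simp only: X Suc.IH sum.lessThan_Suc mult_zero_right add_0)
qed simp

text \<open>Convergence at the points of (0, 1) forces radius of convergence at least 1, so one
  coefficient sequence serves every r < 1. Mean inequalities for polynomials then extend to
  holomorphic functions by limits.\<close>

lemma taylor_uniform_limit:
  assumes "g holomorphic_on ball 0 1"
  obtains a where "\<And>r. r < 1 \<Longrightarrow> uniform_limit (cball 0 r) (\<lambda>n z. \<Sum>i<n. a i * z ^ i) g sequentially"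
proof -
  define a where "a = (\<lambda>n. (deriv ^^ n) g 0 / fact n)"
  have sums: "(\<lambda>n. a n * z ^ n) sums g z" if "norm z < 1" for z
    using holomorphic_power_series[OF assms, of z] that by (simp add: a_def)
  have "1 \<le> conv_radius a"
  proof (rule conv_radius_geI_ex)
    fix r :: real assume "0 < r" "ereal r < 1"
    then show "\<exists>z. norm z = r \<and> summable (\<lambda>n. a n * z ^ n)"
      using sums[of "of_real r"] by (intro exI[of _ "of_real r"]) (auto simp: sums_iff)
  qed
  then have r: "ereal r < conv_radius a" if "r < 1" for r :: real
    using that by (metis ereal_less(3) less_le_trans)
  have "uniform_limit (cball 0 r) (\<lambda>n z. \<Sum>i<n. a i * z ^ i) g sequentially" if "r < 1" for r
  proof -
    have "uniform_limit (cball 0 r) (\<lambda>n z. \<Sum>i<n. a i * z ^ i) (\<lambda>z. \<Sum>i. a i * z ^ i) sequentially"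
      using powser_uniform_limit[OF r[OF that], of 0] by simp
    then show ?thesis
      by (rule uniform_limit_cong[THEN iffD1, rotated -1])
        (use that sums in \<open>auto simp: sums_iff\<close>)
  qed
  with that show ?thesis by blast
qed

text \<open>In terms of Taylor coefficients this is \<open>(1 - s ^ n)\<^sup>2 \<le> 1 - (s ^ n)\<^sup>2\<close>.\<close>

lemma circle_mean_square_dilate_diff:
  assumes g: "g holomorphic_on ball 0 1" and r: "0 \<le> r" "r < 1" and s: "0 \<le> s" "s \<le> 1"
  shows "circle_mean (\<lambda>z. (norm (g (of_real r * z) - g (of_real (s * r) * z)))\<^sup>2)
    \<le> circle_mean (\<lambda>z. (norm (g (of_real r * z)))\<^sup>2) - circle_mean (\<lambda>z. (norm (g (of_real (s * r) * z)))\<^sup>2)"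
proof -
  obtain a where a: "uniform_limit (cball 0 r) (\<lambda>n z. \<Sum>i<n. a i * z ^ i) g sequentially"
    using taylor_uniform_limit[OF g] r by metis
  define P where "P n z = (\<Sum>i<n. a i * z ^ i)" for n z
  have lim: "uniform_limit (sphere 0 1) (\<lambda>n z. P n (of_real t * z)) (\<lambda>z. g (of_real t * z)) sequentially"
    if "0 \<le> t" "t \<le> r" for t
    unfolding P_def by (rule uniform_limit_compose'[OF a]) (use that in \<open>auto simp: norm_mult\<close>)
  have contP: "continuous_on A (\<lambda>z. P n (of_real t * z))" for A n t
    unfolding P_def by (intro continuous_intros)
  have sr: "0 \<le> s * r" "s * r \<le> r"
    using r s by (auto simp: mult_left_le_one_le)
  have lims: "(\<lambda>n. circle_mean (\<lambda>z. (norm (P n (of_real r * z)))\<^sup>2)) \<longlonglongrightarrow> circle_mean (\<lambda>z. (norm (g (of_real r * z)))\<^sup>2)"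
      "(\<lambda>n. circle_mean (\<lambda>z. (norm (P n (of_real (s * r) * z)))\<^sup>2)) \<longlonglongrightarrow> circle_mean (\<lambda>z. (norm (g (of_real (s * r) * z)))\<^sup>2)"
      "(\<lambda>n. circle_mean (\<lambda>z. (norm (P n (of_real r * z) - P n (of_real (s * r) * z)))\<^sup>2)) \<longlonglongrightarrow>
       circle_mean (\<lambda>z. (norm (g (of_real r * z) - g (of_real (s * r) * z)))\<^sup>2)"
    using circle_mean_norm_limit(2)[OF lim[of r] contP] circle_mean_norm_limit(2)[OF lim[of "s * r"] contP]
      circle_mean_norm_limit(2)[OF uniform_limit_minus[OF lim[of r] lim[of "s * r"]] continuous_on_diff[OF contP contP]]
      r sr by simp_all
  \<comment> \<open>Weak inequalities survive the limit, so Taylor polynomials suffice, and for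
    these Parseval turns all three means into finite sums.\<close>
  show ?thesis
  proof (rule tendsto_le[OF sequentially_bot tendsto_diff[OF lims(1,2)] lims(3)] , rule always_eventually, rule allI)
    fix n
    have P: "P n (of_real t * z) = (\<Sum>i<n. (a i * of_real t ^ i) * z ^ i)" for t z
      by (simp add: P_def power_mult_distrib mult_ac)
    have Pd: "P n (of_real r * z) - P n (of_real (s * r) * z) = (\<Sum>i<n. (a i * of_real (r ^ i * (1 - s ^ i))) * z ^ i)" for z
      by (simp add: P_def power_mult_distrib algebra_simps flip: sum_subtractf)
    have "circle_mean (\<lambda>z. (norm (P n (of_real r * z) - P n (of_real (s * r) * z)))\<^sup>2) =
        (\<Sum>i<n. (norm (a i))\<^sup>2 * (r ^ i)\<^sup>2 * (1 - s ^ i)\<^sup>2)"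
      unfolding Pd circle_mean_parseval by (simp only: norm_mult norm_of_real power_mult_distrib power2_abs mult.assoc)
    also have "\<dots> \<le> (\<Sum>i<n. (norm (a i))\<^sup>2 * (r ^ i)\<^sup>2 * (1 - (s ^ i)\<^sup>2))"
    proof (intro sum_mono mult_left_mono)
      fix i
      have "0 \<le> s ^ i" "s ^ i \<le> 1" using s by (auto simp: power_le_one)
      then have "(1 - s ^ i) * (1 - s ^ i) \<le> (1 - s ^ i) * (1 + s ^ i)"
        by (intro mult_left_mono) auto
      then show "(1 - s ^ i)\<^sup>2 \<le> 1 - (s ^ i)\<^sup>2"
        by (simp add: power2_eq_square algebra_simps)
    qed auto
    also have "\<dots> = circle_mean (\<lambda>z. (norm (P n (of_real r * z)))\<^sup>2) - circle_mean (\<lambda>z. (norm (P n (of_real (s * r) * z)))\<^sup>2)"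
      unfolding P circle_mean_parseval sum_subtractf[symmetric]
      by (intro sum.cong) (use r s in \<open>simp_all add: norm_mult norm_power power_mult_distrib algebra_simps\<close>)
    finally show "circle_mean (\<lambda>z. (norm (P n (of_real r * z) - P n (of_real (s * r) * z)))\<^sup>2)
       \<le> circle_mean (\<lambda>z. (norm (P n (of_real r * z)))\<^sup>2) - circle_mean (\<lambda>z. (norm (P n (of_real (s * r) * z)))\<^sup>2)" .
  qed
qed

subsection \<open>Zero-free majorants\<close>

text \<open>Each factor z - a with |a| < 1 is replaced by 1 - conj(a) z, that is, p is divided by a
  finite Blaschke product. Zeros on the circle stay, so only the open disk becomes free of
  zeros.\<close>

lemma poly_zero_free_majorant:
  fixes p :: "complex poly"
  assumes "p \<noteq> 0"
  obtains F where "\<And>z. norm z < 1 \<Longrightarrow> poly F z \<noteq> 0"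
    "\<And>z. norm z = 1 \<Longrightarrow> norm (poly F z) = norm (poly p z)"
    "\<And>z. norm z \<le> 1 \<Longrightarrow> norm (poly p z) \<le> norm (poly F z)"
proof -
  have "\<exists>F. (\<forall>z. norm z < 1 \<longrightarrow> poly F z \<noteq> 0) \<and> (\<forall>z. norm z = 1 \<longrightarrow> norm (poly F z) = norm (poly p z)) \<and>
     (\<forall>z. norm z \<le> 1 \<longrightarrow> norm (poly p z) \<le> norm (poly F z))"
    using assms
  proof (induction "degree p" arbitrary: p rule: less_induct)
    case less
    show ?case
    proof (cases "\<exists>a. norm a < 1 \<and> poly p a = 0")
      case False
      then show ?thesis by blast
    next
      case True
      then obtain a where a: "norm a < 1" "poly p a = 0" by blast
      then obtain q where q: "p = [:- a, 1:] * q" by (auto simp: poly_eq_0_iff_dvd)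
      with less.prems have "q \<noteq> 0" by auto
      then have "degree p = Suc (degree q)" unfolding q by (subst degree_mult_eq) auto
      then obtain F where F: "\<And>z. norm z < 1 \<Longrightarrow> poly F z \<noteq> 0"
        "\<And>z. norm z = 1 \<Longrightarrow> norm (poly F z) = norm (poly q z)"
        "\<And>z. norm z \<le> 1 \<Longrightarrow> norm (poly q z) \<le> norm (poly F z)"
        using less.hyps[of q] \<open>q \<noteq> 0\<close> by auto
      \<comment> \<open>One identity gives both comparisons: its right-hand side is nonnegative in
        the closed disk and vanishes on the circle.\<close>
      have id: "(norm (1 - cnj a * z))\<^sup>2 - (norm (z - a))\<^sup>2 = (1 - (norm a)\<^sup>2) * (1 - (norm z)\<^sup>2)" for z
        unfolding cmod_power2 by (simp add: power2_eq_square algebra_simps)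
      have le: "norm (z - a) \<le> norm (1 - cnj a * z)" if "norm z \<le> 1" for z
      proof -
        have "0 \<le> (1 - (norm a)\<^sup>2) * (1 - (norm z)\<^sup>2)"
          using a(1) that by (intro mult_nonneg_nonneg) (auto simp: power_le_one)
        then show ?thesis
          unfolding id[of z, symmetric] diff_ge_0_iff_ge by (rule power2_le_imp_le) simp
      qed
      have eq: "norm (1 - cnj a * z) = norm (z - a)" if "norm z = 1" for z
        using id[of z] that by (simp add: power2_eq_iff_nonneg)
      have nz: "1 - cnj a * z \<noteq> 0" if "norm z < 1" for z
        using szego_denominator_nonzero[OF a(1)] that by auto
      have e: "poly ([:1, - cnj a:] * F) z = (1 - cnj a * z) * poly F z" "poly p z = (z - a) * poly q z" for z
        by (simp_all add: q algebra_simps)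
      show ?thesis
      proof (intro exI[of _ "[:1, - cnj a:] * F"] conjI allI impI)
        fix z :: complex assume z: "norm z < 1"
        show "poly ([:1, - cnj a:] * F) z \<noteq> 0"
          unfolding e using F(1)[OF z] nz[OF z] by simp
      next
        fix z :: complex assume z: "norm z = 1"
        show "norm (poly ([:1, - cnj a:] * F) z) = norm (poly p z)"
          unfolding e norm_mult using F(2)[OF z] eq[OF z] by simp
      next
        fix z :: complex assume z: "norm z \<le> 1"
        have "norm (z - a) * norm (poly q z) \<le> norm (1 - cnj a * z) * norm (poly F z)"
          using F(3)[OF z] le[OF z] by (intro mult_mono) auto
        then show "norm (poly p z) \<le> norm (poly ([:1, - cnj a:] * F) z)"
          unfolding e norm_mult .
      qed
    qed
  qed
  with that show ?thesis by blast
qed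

subsection \<open>Mean convergence of dilations\<close>

lemma holomorphic_dilate:
  assumes "f holomorphic_on ball 0 1" "\<bar>r\<bar> \<le> 1"
  shows "(\<lambda>z. f (of_real r * z)) holomorphic_on ball 0 1"
proof -
  have "(\<lambda>z. of_real r * z) ` ball 0 1 \<subseteq> ball (0::complex) 1"
  proof safe
    fix z :: complex assume "z \<in> ball 0 1"
    moreover have "\<bar>r\<bar> * norm z \<le> norm z" using assms(2) by (simp add: mult_left_le_one_le)
    ultimately show "of_real r * z \<in> ball 0 1" by (simp add: norm_mult)
  qed
  moreover have "(\<lambda>z. of_real r * z) holomorphic_on ball 0 1" by (intro holomorphic_intros)
  ultimately have "f \<circ> (\<lambda>z. of_real r * z) holomorphic_on ball 0 1"
    using assms(1) by (intro holomorphic_on_compose_gen)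
  then show ?thesis by (simp add: o_def)
qed

lemma hardy_mean_holomorphic:
  assumes "f holomorphic_on ball 0 1" "0 \<le> r" "r < 1"
  shows "hardy_mean f r = circle_mean (\<lambda>z. norm (f (of_real r * z)))"
proof (rule hardy_mean_eq_circle_mean)
  have "sphere 0 \<bar>r\<bar> \<subseteq> ball (0::complex) 1" using assms by auto
  then show "continuous_on (sphere 0 \<bar>r\<bar>) f"
    using assms(1) holomorphic_on_imp_continuous_on continuous_on_subset by blast
qed

text \<open>The free weight is what makes the later estimate useful: x will have a merely bounded
  square mean and gets the small factor, while y, a difference of dilates, absorbs 1 /
  \<open>\<eta>\<close>.\<close>

lemma mult_le_weighted_squares:
  fixes x y :: real
  assumes "0 < \<eta>"
  shows "x * y \<le> \<eta> / 2 * x\<^sup>2 + 1 / (2 * \<eta>) * y\<^sup>2"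
proof -
  have "0 \<le> (\<eta> * x - y)\<^sup>2 / (2 * \<eta>)" using assms by simp
  also have "\<dots> = \<eta> / 2 * x\<^sup>2 + 1 / (2 * \<eta>) * y\<^sup>2 - x * y"
    using assms by (simp add: power2_eq_square field_simps)
  finally show ?thesis by simp
qed

text \<open>With \<open>F = g\<^sup>2\<close> and \<open>p = h * g\<close>, the square-mean estimate applies to \<open>g\<close> and to \<open>h\<close>.\<close>

lemma circle_mean_dilate_diff_majorant:
  fixes p F :: "complex \<Rightarrow> complex"
  assumes p: "p holomorphic_on ball 0 1" and F: "F holomorphic_on ball 0 1"
    and nz: "\<And>z. z \<in> ball 0 1 \<Longrightarrow> F z \<noteq> 0"
    and le: "\<And>z. z \<in> ball 0 1 \<Longrightarrow> norm (p z) \<le> norm (F z)"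
    and r: "0 \<le> r" "r < 1" and s: "0 \<le> s" "s \<le> 1" and \<eta>: "0 < \<eta>"
  shows "circle_mean (\<lambda>z. norm (p (of_real r * z) - p (of_real (s * r) * z)))
    \<le> \<eta> * circle_mean (\<lambda>z. norm (F (of_real r * z)))
      + (circle_mean (\<lambda>z. norm (F (of_real r * z))) - circle_mean (\<lambda>z. norm (p (of_real (s * r) * z)))) / \<eta>"
proof -
  obtain g where g: "g holomorphic_on ball 0 1" and Fg: "\<And>z. z \<in> ball 0 1 \<Longrightarrow> F z = g z ^ 2"
    using contractible_imp_holomorphic_sqrt[OF F convex_imp_contractible[OF convex_ball] nz] by metis
  have gnz: "g z \<noteq> 0" if "z \<in> ball 0 1" for z
    using nz[OF that] Fg[OF that] by auto
  define h where "h z = p z / g z" for z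
  have h: "h holomorphic_on ball 0 1"
    unfolding h_def by (intro holomorphic_intros p g gnz)
  have ph: "p z = h z * g z" if "z \<in> ball 0 1" for z
    using gnz[OF that] by (simp add: h_def)
  have hg: "norm (h z) \<le> norm (g z)" if "z \<in> ball 0 1" for z
    using le[OF that] gnz[OF that]
    by (simp add: h_def norm_divide Fg[OF that] norm_power norm_mult power2_eq_square divide_le_eq)
  have sr: "0 \<le> s * r" "s * r < 1"
    using r s mult_left_le_one_le[of r s] by auto
  have cont: "continuous_on (sphere 0 1) (\<lambda>z. f (of_real t * z))"
    if "f holomorphic_on ball 0 1" "0 \<le> t" "t < 1" for f t
    by (rule continuous_on_dilate) (use that in \<open>auto intro: holomorphic_on_imp_continuous_on\<close>)
  note c = cont[OF g r] cont[OF g sr] cont[OF h r] cont[OF h sr] cont[OF p r] cont[OF p sr] cont[OF F r]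
  have inb: "of_real t * z \<in> ball 0 1" if "norm z = 1" "0 \<le> t" "t < 1" for z :: complex and t
    using that by (simp add: norm_mult)
  let ?gr = "\<lambda>z. g (of_real r * z)" and ?gs = "\<lambda>z. g (of_real (s * r) * z)"
  let ?hr = "\<lambda>z. h (of_real r * z)" and ?hs = "\<lambda>z. h (of_real (s * r) * z)"
  let ?m = "\<lambda>\<phi>. circle_mean (\<lambda>z. (norm (\<phi> z :: complex))\<^sup>2)"
  have cm: "continuous_on (sphere 0 1) (\<lambda>z. (norm (\<phi> z :: complex))\<^sup>2)"
    if "continuous_on (sphere 0 1) \<phi>" for \<phi> :: "complex \<Rightarrow> complex"
    by (intro continuous_on_power continuous_on_norm that)
  have E: "circle_mean (\<lambda>z. norm (F (of_real r * z))) = ?m ?gr"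
    by (rule circle_mean_cong) (use Fg[OF inb] r in \<open>auto simp: norm_power\<close>)
  have G: "?m (\<lambda>z. ?gr z - ?gs z) \<le> ?m ?gr - ?m ?gs" and H: "?m (\<lambda>z. ?hr z - ?hs z) \<le> ?m ?hr - ?m ?hs"
    by (rule circle_mean_square_dilate_diff[OF g r s] circle_mean_square_dilate_diff[OF h r s])+
  have "0 \<le> ?m (\<lambda>z. ?gr z - ?gs z)"
    by (intro circle_mean_nonneg cm continuous_on_diff c) auto
  then have ba: "?m ?gs \<le> ?m ?gr" using G by simp
  have ca: "?m ?hr \<le> ?m ?gr"
    by (intro circle_mean_mono cm c power_mono hg inb r norm_ge_zero)
  \<comment> \<open>Since |p| = |h| |g|, the drops of the square means of g and h below that of g at
    radius r add up to at most twice the drop in the claim.\<close>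
  have \<alpha>: "circle_mean (\<lambda>z. norm (p (of_real (s * r) * z))) \<le> 1 / 2 * ?m ?hs + 1 / 2 * ?m ?gs"
  proof -
    have "circle_mean (\<lambda>z. norm (p (of_real (s * r) * z))) \<le>
        circle_mean (\<lambda>z. 1 / 2 * (norm (?hs z))\<^sup>2 + 1 / 2 * (norm (?gs z))\<^sup>2)"
    proof (intro circle_mean_mono continuous_on_add continuous_on_mult_left cm c continuous_on_norm)
      fix z :: complex assume "norm z = 1"
      then show "norm (p (of_real (s * r) * z)) \<le> 1 / 2 * (norm (?hs z))\<^sup>2 + 1 / 2 * (norm (?gs z))\<^sup>2"
        using mult_le_weighted_squares[of 1 "norm (?hs z)" "norm (?gs z)"] ph[OF inb[OF _ sr]]
        by (simp add: norm_mult)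
    qed
    also have "\<dots> = 1 / 2 * ?m ?hs + 1 / 2 * ?m ?gs"
      by (simp only: circle_mean_add circle_mean_mult_left continuous_on_mult_left cm c)
    finally show ?thesis .
  qed
  have "circle_mean (\<lambda>z. norm (p (of_real r * z) - p (of_real (s * r) * z))) \<le>
      circle_mean (\<lambda>z. (\<eta> / 2 * (norm (?hr z))\<^sup>2 + 1 / (2 * \<eta>) * (norm (?gr z - ?gs z))\<^sup>2)
        + (\<eta> / 2 * (norm (?gs z))\<^sup>2 + 1 / (2 * \<eta>) * (norm (?hr z - ?hs z))\<^sup>2))"
  proof (intro circle_mean_mono continuous_on_add continuous_on_mult_left cm c continuous_on_norm continuous_on_diff)
    fix z :: complex assume z: "norm z = 1"
    \<comment> \<open>The product rule for differences: each summand pairs one function with a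
      difference of dilates of the other.\<close>
    have "p (of_real r * z) - p (of_real (s * r) * z) = ?hr z * (?gr z - ?gs z) + ?gs z * (?hr z - ?hs z)"
      unfolding ph[OF inb[OF z r]] ph[OF inb[OF z sr]] by (simp add: algebra_simps)
    then have "norm (p (of_real r * z) - p (of_real (s * r) * z)) \<le>
        norm (?hr z) * norm (?gr z - ?gs z) + norm (?gs z) * norm (?hr z - ?hs z)"
      by (metis norm_mult norm_triangle_ineq)
    also have "\<dots> \<le> (\<eta> / 2 * (norm (?hr z))\<^sup>2 + 1 / (2 * \<eta>) * (norm (?gr z - ?gs z))\<^sup>2)
        + (\<eta> / 2 * (norm (?gs z))\<^sup>2 + 1 / (2 * \<eta>) * (norm (?hr z - ?hs z))\<^sup>2)"
      by (intro add_mono mult_le_weighted_squares \<eta>)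
    finally show "norm (p (of_real r * z) - p (of_real (s * r) * z)) \<le> \<dots>" .
  qed
  also have "\<dots> = (\<eta> / 2 * ?m ?hr + 1 / (2 * \<eta>) * ?m (\<lambda>z. ?gr z - ?gs z))
      + (\<eta> / 2 * ?m ?gs + 1 / (2 * \<eta>) * ?m (\<lambda>z. ?hr z - ?hs z))"
    by (simp only: circle_mean_add circle_mean_mult_left continuous_on_mult_left continuous_on_add continuous_on_diff cm c)
  \<comment> \<open>The square means of h at radius r and of g at radius s r are both replaced by
    that of g at radius r, which is the mean of |F|.\<close>
  also have "\<dots> \<le> (\<eta> / 2 * ?m ?gr + 1 / (2 * \<eta>) * (?m ?gr - ?m ?gs))
      + (\<eta> / 2 * ?m ?gr + 1 / (2 * \<eta>) * (?m ?gr - ?m ?hs))"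
    using G H ba ca \<eta> by (intro add_mono mult_left_mono) auto
  also have "\<dots> = \<eta> * ?m ?gr + (?m ?gr - (1 / 2 * ?m ?hs + 1 / 2 * ?m ?gs)) / \<eta>"
    using \<eta> by (simp add: field_simps)
  also have "\<dots> \<le> \<eta> * ?m ?gr + (?m ?gr - circle_mean (\<lambda>z. norm (p (of_real (s * r) * z)))) / \<eta>"
    using \<alpha> \<eta> by (intro add_left_mono divide_right_mono) auto
  finally show ?thesis unfolding E .
qed

text \<open>The shift by 2 keeps all these radii in [1/2, 1), also for n = 0.\<close>

lemma tendsto_one_minus_inverse: "(\<lambda>n. 1 - 1 / (real n + 2)) \<longlonglongrightarrow> 1"
  by real_asymp

lemma circle_mean_norm_dilation_limit:
  fixes \<phi> :: "complex \<Rightarrow> complex"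
  assumes "continuous_on (cball 0 1) \<phi>"
  shows "(\<lambda>n. circle_mean (\<lambda>z. norm (\<phi> (of_real (1 - 1 / (real n + 2)) * z)))) \<longlonglongrightarrow> circle_mean (\<lambda>z. norm (\<phi> z))"
proof (rule circle_mean_norm_limit)
  show "uniform_limit (sphere 0 1) (\<lambda>n z. \<phi> (of_real (1 - 1 / (real n + 2)) * z)) \<phi> sequentially"
    by (rule uniform_limit_on_subset[OF uniform_limit_dilation[OF assms tendsto_one_minus_inverse]])
      (auto simp: abs_if field_simps)
  show "continuous_on (sphere 0 1) (\<lambda>z. \<phi> (of_real (1 - 1 / (real n + 2)) * z))" for n
    by (rule continuous_on_dilate) (auto intro: continuous_on_subset[OF assms] simp: abs_if field_simps)
qed

text \<open>On the circle itself |F| = |p|, so the majorant disappears from the bound. As F may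
  vanish there, the estimate is taken at radii r < 1 and passed to the limit.\<close>

lemma circle_mean_poly_dilate_diff:
  fixes p :: "complex poly"
  assumes s: "0 \<le> s" "s \<le> 1" and \<eta>: "0 < \<eta>"
  shows "circle_mean (\<lambda>z. norm (poly p z - poly p (of_real s * z)))
    \<le> \<eta> * circle_mean (\<lambda>z. norm (poly p z))
      + (circle_mean (\<lambda>z. norm (poly p z)) - circle_mean (\<lambda>z. norm (poly p (of_real s * z)))) / \<eta>"
proof (cases "p = 0")
  case False
  obtain F where F: "\<And>z. norm z < 1 \<Longrightarrow> poly F z \<noteq> 0"
    "\<And>z. norm z = 1 \<Longrightarrow> norm (poly F z) = norm (poly p z)"
    "\<And>z. norm z \<le> 1 \<Longrightarrow> norm (poly p z) \<le> norm (poly F z)"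
    using poly_zero_free_majorant[OF False] by metis
  define r where "r n = 1 - 1 / (real n + 2)" for n :: nat
  have r: "0 \<le> r n" "r n < 1" for n by (auto simp: r_def field_simps)
  have lim: "(\<lambda>n. circle_mean (\<lambda>z. norm (\<phi> (of_real (r n) * z)))) \<longlonglongrightarrow> circle_mean (\<lambda>z. norm (\<phi> z))"
    if "continuous_on (cball 0 1) \<phi>" for \<phi> :: "complex \<Rightarrow> complex"
    using circle_mean_norm_dilation_limit[OF that] by (simp only: r_def)
  have eqF: "circle_mean (\<lambda>z. norm (poly F z)) = circle_mean (\<lambda>z. norm (poly p z))"
    by (rule circle_mean_cong) (rule F(2))
  have limF: "(\<lambda>n. circle_mean (\<lambda>z. norm (poly F (of_real (r n) * z)))) \<longlonglongrightarrow> circle_mean (\<lambda>z. norm (poly p z))"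
    unfolding eqF[symmetric] by (rule lim) (intro continuous_intros)
  have limd: "(\<lambda>n. circle_mean (\<lambda>z. norm (poly p (of_real (r n) * z) - poly p (of_real s * (of_real (r n) * z)))))
      \<longlonglongrightarrow> circle_mean (\<lambda>z. norm (poly p z - poly p (of_real s * z)))"
    by (rule lim[of "\<lambda>z. poly p z - poly p (of_real s * z)"]) (intro continuous_intros)
  have lims: "(\<lambda>n. circle_mean (\<lambda>z. norm (poly p (of_real s * (of_real (r n) * z)))))
      \<longlonglongrightarrow> circle_mean (\<lambda>z. norm (poly p (of_real s * z)))"
    by (rule lim[of "\<lambda>z. poly p (of_real s * z)"]) (intro continuous_intros)
  show ?thesis
  proof (rule tendsto_le[OF sequentially_bot tendsto_add[OF tendsto_mult[OF tendsto_const limF]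
        tendsto_divide[OF tendsto_diff[OF limF lims] tendsto_const]] limd])
    show "\<forall>\<^sub>F n in sequentially. circle_mean (\<lambda>z. norm (poly p (of_real (r n) * z) - poly p (of_real s * (of_real (r n) * z))))
       \<le> \<eta> * circle_mean (\<lambda>z. norm (poly F (of_real (r n) * z))) +
         (circle_mean (\<lambda>z. norm (poly F (of_real (r n) * z))) - circle_mean (\<lambda>z. norm (poly p (of_real s * (of_real (r n) * z))))) / \<eta>"
    proof (rule always_eventually, rule allI)
      fix n
      show "circle_mean (\<lambda>z. norm (poly p (of_real (r n) * z) - poly p (of_real s * (of_real (r n) * z))))
       \<le> \<eta> * circle_mean (\<lambda>z. norm (poly F (of_real (r n) * z))) +
         (circle_mean (\<lambda>z. norm (poly F (of_real (r n) * z))) - circle_mean (\<lambda>z. norm (poly p (of_real s * (of_real (r n) * z))))) / \<eta>"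
        using circle_mean_dilate_diff_majorant[of "poly p" "poly F" "r n" s \<eta>] F(1,3) r s \<eta>
        by (simp add: mult.assoc poly_holomorphic_on)
    qed
  qed (use \<eta> in simp)
qed simp

text \<open>This is the substitute for boundary values: where the mean hardly grows from radius s t
  to t, the two dilates are close in mean, once \<open>\<eta>\<close> is chosen small.\<close>

lemma circle_mean_dilate_diff:
  assumes f: "f holomorphic_on ball 0 1" and t: "0 \<le> t" "t < 1" and s: "0 \<le> s" "s \<le> 1" and \<eta>: "0 < \<eta>"
  shows "circle_mean (\<lambda>z. norm (f (of_real t * z) - f (of_real (s * t) * z)))
    \<le> \<eta> * hardy_mean f t + (hardy_mean f t - hardy_mean f (s * t)) / \<eta>"
proof -
  obtain a where a: "uniform_limit (cball 0 t) (\<lambda>n z. \<Sum>i<n. a i * z ^ i) f sequentially"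
    using taylor_uniform_limit[OF f] t by metis
  \<comment> \<open>The powers of t go into the coefficients, so that the polynomial estimate
    applies on the unit circle and only s remains as dilation.\<close>
  define p where "p n = (\<Sum>i<n. monom (a i * of_real t ^ i) i)" for n
  have p: "poly (p n) z = (\<Sum>i<n. a i * (of_real t * z) ^ i)" for n z
    by (simp add: p_def poly_sum poly_monom power_mult_distrib mult_ac)
  have st: "0 \<le> s * t" "s * t < 1"
    using t s mult_left_le_one_le[of t s] by auto
  have lim: "uniform_limit (sphere 0 1) (\<lambda>n z. poly (p n) (of_real u * z)) (\<lambda>z. f (of_real (u * t) * z)) sequentially"
    if "0 \<le> u" "u \<le> 1" for u
  proof -
    have "uniform_limit (sphere 0 1) (\<lambda>n z. \<Sum>i<n. a i * (of_real (u * t) * z) ^ i) (\<lambda>z. f (of_real (u * t) * z)) sequentially"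
      by (rule uniform_limit_compose'[OF a]) (use that t in \<open>auto simp: norm_mult mult_left_le_one_le\<close>)
    then show ?thesis by (simp add: p mult_ac)
  qed
  have lim1: "uniform_limit (sphere 0 1) (\<lambda>n z. poly (p n) z) (\<lambda>z. f (of_real t * z)) sequentially"
    using lim[of 1] by simp
  have c: "continuous_on (sphere 0 1) (\<lambda>z. poly (p n) (of_real s * z))" "continuous_on (sphere 0 1) (\<lambda>z. poly (p n) z)" for n
    by (intro continuous_intros)+
  note L = circle_mean_norm_limit(1)
  show ?thesis
    unfolding hardy_mean_holomorphic[OF f t] hardy_mean_holomorphic[OF f st]
  proof (rule tendsto_le[OF sequentially_bot tendsto_add[OF tendsto_mult[OF tendsto_const L[OF lim1 c(2)]]
        tendsto_divide[OF tendsto_diff[OF L[OF lim1 c(2)] L[OF lim[OF s] c(1)]] tendsto_const]]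
        L[OF uniform_limit_minus[OF lim1 lim[OF s]] continuous_on_diff[OF c(2,1)]]])
    show "\<forall>\<^sub>F n in sequentially. circle_mean (\<lambda>z. norm (poly (p n) z - poly (p n) (of_real s * z)))
       \<le> \<eta> * circle_mean (\<lambda>z. norm (poly (p n) z)) +
         (circle_mean (\<lambda>z. norm (poly (p n) z)) - circle_mean (\<lambda>z. norm (poly (p n) (of_real s * z)))) / \<eta>"
      by (intro always_eventually allI circle_mean_poly_dilate_diff s \<eta>)
  qed (use \<eta> in simp)
qed

section \<open>Monotonicity of the means and density of dilates in H^1\<close>

lemma hardy_mean_nonneg: "0 \<le> hardy_mean f r"
  unfolding hardy_mean_def by simp

text \<open>A by-product of \<open>circle_mean_dilate_diff\<close>: if the mean dropped with growing
  radius, a small \<open>\<eta>\<close> would make the upper bound for a nonnegative mean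
  negative.\<close>

lemma hardy_mean_dilate_le:
  assumes f: "f holomorphic_on ball 0 1" and t: "0 \<le> t" "t < 1" and s: "0 \<le> s" "s \<le> 1"
  shows "hardy_mean f (s * t) \<le> hardy_mean f t"
proof (rule ccontr)
  let ?A = "hardy_mean f t" and ?B = "hardy_mean f (s * t)"
  assume "\<not> ?B \<le> ?A"
  then have D: "0 < ?B - ?A" by simp
  have A: "0 \<le> ?A" by (rule hardy_mean_nonneg)
  \<comment> \<open>Chosen so that \<open>\<eta>\<close> times the upper bound equals
    -\<open>\<eta>\<close>^2; the summand 1 keeps the denominator positive when \<open>?A\<close>
    vanishes.\<close>
  define \<eta> where "\<eta> = sqrt ((?B - ?A) / (?A + 1))"
  have \<eta>: "0 < \<eta>" using D A by (simp add: \<eta>_def)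
  have \<eta>2: "\<eta> * \<eta> * (?A + 1) = ?B - ?A" using D A by (simp add: \<eta>_def)
  have st: "0 \<le> s * t" "s * t < 1"
    using t s mult_left_le_one_le[of t s] by auto
  have cf: "continuous_on (ball 0 1) f"
    using f by (rule holomorphic_on_imp_continuous_on)
  have "0 \<le> circle_mean (\<lambda>z. norm (f (of_real t * z) - f (of_real (s * t) * z)))"
    by (intro circle_mean_nonneg continuous_on_norm continuous_on_diff continuous_on_dilate[OF cf])
      (use t st in auto)
  also have "\<dots> \<le> \<eta> * ?A + (?A - ?B) / \<eta>"
    by (rule circle_mean_dilate_diff[OF f t s \<eta>])
  finally have "0 \<le> \<eta> * (\<eta> * ?A + (?A - ?B) / \<eta>)"
    using \<eta> by simp
  also have "\<dots> = \<eta> * \<eta> * ?A + (?A - ?B)"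
    using \<eta> by (simp add: field_simps)
  also have "\<dots> = - (\<eta> * \<eta>)"
    using \<eta>2 by (simp add: algebra_simps)
  finally show False using \<eta> by (simp add: mult_le_0_iff)
qed

lemma H1_spaceI:
  assumes "f holomorphic_on ball 0 1"
    "\<And>r. 0 < r \<Longrightarrow> r < 1 \<Longrightarrow> circle_mean (\<lambda>z. norm (f (of_real r * z))) \<le> B"
  shows "f \<in> H1_space" "H1_norm f \<le> B"
proof -
  have le: "hardy_mean f r \<le> B" if "r \<in> {0<..<1}" for r
    using assms(2)[of r] hardy_mean_holomorphic[OF assms(1), of r] that by simp
  then show "f \<in> H1_space"
    unfolding H1_space_def using assms(1) by (auto intro!: bdd_aboveI2[of _ _ B])
  show "H1_norm f \<le> B"
    unfolding H1_norm_def by (rule cSUP_least) (use le in auto)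
qed

lemma H1_space_holomorphic: "f \<in> H1_space \<Longrightarrow> f holomorphic_on ball 0 1"
  by (simp add: H1_space_def)

lemma hardy_mean_le_H1_norm:
  assumes "f \<in> H1_space" "0 < r" "r < 1"
  shows "hardy_mean f r \<le> H1_norm f"
  unfolding H1_norm_def using assms by (intro cSUP_upper) (auto simp: H1_space_def)

lemma H1_norm_nonneg:
  assumes "f \<in> H1_space"
  shows "0 \<le> H1_norm f"
  using hardy_mean_le_H1_norm[OF assms, of "1/2"] hardy_mean_nonneg[of f "1/2"] by simp

text \<open>A single \<open>\<rho>\<close> must serve all radii r. Beyond \<open>r0\<close> the
  means are nearly at their supremum, so the dilates are close because the means can hardly grow any
  more; at smaller radii everything happens in a compact subset of the disk, where uniform
  continuity suffices.\<close>

lemma H1_dilation_dense: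
  assumes f: "f \<in> H1_space" and e: "0 < e"
  obtains \<rho> where "0 < \<rho>" "\<rho> < 1" "(\<lambda>z. f z - f (of_real \<rho> * z)) \<in> H1_space"
    "H1_norm (\<lambda>z. f z - f (of_real \<rho> * z)) \<le> e"
proof -
  have hf: "f holomorphic_on ball 0 1" using f by (rule H1_space_holomorphic)
  then have cf: "continuous_on (ball 0 1) f" by (rule holomorphic_on_imp_continuous_on)
  define L where "L = H1_norm f"
  have L: "0 \<le> L" unfolding L_def by (rule H1_norm_nonneg[OF f])
  \<comment> \<open>Makes \<open>\<eta> * L\<close> at most e / 2; the growth of the means is then
    allowed to be \<open>\<eta> * (e / 2)\<close>, which contributes the other half after division
    by \<open>\<eta>\<close>.\<close>
  define \<eta> where "\<eta> = e / (2 * (L + 1))"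
  have \<eta>: "0 < \<eta>" using e L by (simp add: \<eta>_def)
  have \<eta>L: "\<eta> * L \<le> e / 2" using e L by (simp add: \<eta>_def field_simps)
  have "L - \<eta> * (e / 2) < (SUP r\<in>{0<..<1}. hardy_mean f r)"
    using e \<eta> by (simp add: L_def H1_norm_def)
  then obtain r0 where r0: "0 < r0" "r0 < 1" "L - \<eta> * (e / 2) < hardy_mean f r0"
    using less_cSUP_iff[of "{0<..<1}" "hardy_mean f"] f by (auto simp: H1_space_def)
  have near: "circle_mean (\<lambda>z. norm (f (of_real t * z) - f (of_real (s * t) * z))) \<le> e"
    if t: "0 < t" "t < 1" and s: "0 \<le> s" "s \<le> 1" and st: "r0 \<le> s * t" for s t
  proof -
    have "s * t \<le> t" using s t by (simp add: mult_left_le_one_le)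
    then have st1: "s * t < 1" using t(2) by linarith
    have "hardy_mean f r0 = hardy_mean f ((r0 / (s * t)) * (s * t))"
      using st r0(1) by auto
    also have "\<dots> \<le> hardy_mean f (s * t)"
      using hardy_mean_dilate_le[OF hf, of "s * t" "r0 / (s * t)"] st st1 r0 by simp
    finally have 1: "hardy_mean f t - hardy_mean f (s * t) \<le> \<eta> * (e / 2)"
      using hardy_mean_le_H1_norm[OF f t] r0(3) by (simp add: L_def)
    have "circle_mean (\<lambda>z. norm (f (of_real t * z) - f (of_real (s * t) * z)))
      \<le> \<eta> * hardy_mean f t + (hardy_mean f t - hardy_mean f (s * t)) / \<eta>"
      by (rule circle_mean_dilate_diff[OF hf]) (use t s \<eta> in auto)
    also have "\<dots> \<le> \<eta> * L + \<eta> * (e / 2) / \<eta>"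
      using \<eta> 1 hardy_mean_le_H1_norm[OF f t]
      by (intro add_mono mult_left_mono divide_right_mono) (auto simp: L_def)
    also have "\<dots> \<le> e" using \<eta>L \<eta> by simp
    finally show ?thesis .
  qed
  \<comment> \<open>Leaves room between the two ranges of radii: if \<open>\<rho>\<close> > r0 / r1,
    then every r with \<open>\<rho> * r\<close> < r0 lies below r1, so no radius escapes both
    cases.\<close>
  define r1 where "r1 = (1 + r0) / 2"
  have r1: "r0 < r1" "r1 < 1" "0 < r1" using r0 by (auto simp: r1_def)
  have c1: "continuous_on (cball 0 1) (\<lambda>z. f (of_real r1 * z))"
    by (rule continuous_on_dilate[OF cf]) (use r1 in auto)
  let ?s = "\<lambda>n. 1 - 1 / (real n + 2)"
  have "uniform_limit (cball 0 1) (\<lambda>n z. f (of_real r1 * (of_real (?s n) * z))) (\<lambda>z. f (of_real r1 * z)) sequentially"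
    by (rule uniform_limit_dilation[OF c1 tendsto_one_minus_inverse]) (auto simp: abs_if field_simps)
  then have "\<forall>\<^sub>F n in sequentially. \<forall>z\<in>cball 0 1. dist (f (of_real r1 * (of_real (?s n) * z))) (f (of_real r1 * z)) < e"
    using e by (rule uniform_limitD)
  moreover have "\<forall>\<^sub>F n in sequentially. r0 / r1 < ?s n"
    by (rule order_tendstoD(1)[OF tendsto_one_minus_inverse]) (use r1 in simp)
  ultimately have "\<exists>n. (\<forall>z\<in>cball 0 1. dist (f (of_real r1 * (of_real (?s n) * z))) (f (of_real r1 * z)) < e) \<and> r0 / r1 < ?s n"
    using eventually_happens[OF eventually_conj] by (metis (mono_tags, lifting) sequentially_bot)
  then obtain n where n: "\<And>z. z \<in> cball 0 1 \<Longrightarrow> dist (f (of_real r1 * (of_real (?s n) * z))) (f (of_real r1 * z)) < e"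
    "r0 / r1 < ?s n" by blast
  define \<rho> where "\<rho> = ?s n"
  have \<rho>: "0 < \<rho>" "\<rho> < 1" by (auto simp: \<rho>_def field_simps)
  have hol: "(\<lambda>z. f z - f (of_real \<rho> * z)) holomorphic_on ball 0 1"
  proof (intro holomorphic_on_diff hf)
    show "(\<lambda>z. f (of_real \<rho> * z)) holomorphic_on ball 0 1"
      by (rule holomorphic_dilate[OF hf]) (use \<rho> in auto)
  qed
  have bound: "circle_mean (\<lambda>z. norm (f (of_real r * z) - f (of_real \<rho> * (of_real r * z)))) \<le> e"
    if r: "0 < r" "r < 1" for r
  proof (cases "r0 \<le> \<rho> * r")
    case True
    then show ?thesis using near[of r \<rho>] r \<rho> by (simp add: mult.assoc)
  next
    case False
    then have "r * \<rho> < r0" by (simp add: mult.commute)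
    moreover have "r0 < r1 * \<rho>" using n(2) r1 by (simp add: \<rho>_def divide_less_eq mult.commute)
    ultimately have "r * \<rho> < r1 * \<rho>" by simp
    then have "r < r1" using \<rho> by simp
    have \<rho>r: "\<rho> * r < 1" using r \<rho> mult_left_le_one_le[of r \<rho>] by linarith
    have "circle_mean (\<lambda>z. norm (f (of_real r * z) - f (of_real \<rho> * (of_real r * z)))) \<le> circle_mean (\<lambda>_. e)"
    proof (intro circle_mean_mono continuous_on_norm continuous_on_diff continuous_on_const)
      show "continuous_on (sphere 0 1) (\<lambda>z. f (of_real r * z))"
        by (rule continuous_on_dilate[OF cf]) (use r in auto)
      show "continuous_on (sphere 0 1) (\<lambda>z. f (of_real \<rho> * (of_real r * z)))"
        using continuous_on_dilate[OF cf, of "\<rho> * r" "sphere 0 1"] r \<rho> \<rho>r by (simp add: mult.assoc)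
      fix z :: complex assume z: "norm z = 1"
      \<comment> \<open>The point r z is r1 times this point, which is where the uniform estimate
        was stated.\<close>
      have "of_real (r / r1) * z \<in> cball 0 1"
        using z r r1 \<open>r < r1\<close> by (simp add: norm_mult norm_divide)
      from n(1)[OF this] have "dist (f (of_real \<rho> * (of_real r * z))) (f (of_real r * z)) < e"
        using r1 unfolding \<rho>_def[symmetric] by (simp add: mult_ac)
      then show "norm (f (of_real r * z) - f (of_real \<rho> * (of_real r * z))) \<le> e"
        by (simp add: dist_norm norm_minus_commute)
    qed
    then show ?thesis by simp
  qed
  show ?thesis
    using that[OF \<rho> H1_spaceI[OF hol bound]] .
qed

subsection \<open>Discretizing the Cauchy integral\<close>

lemma norm_cis_diff_le: "norm (cis a - cis b) \<le> \<bar>a - b\<bar>"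
proof -
  have "norm (cis a - cis b) = norm (cis b * (cis (a - b) - 1))"
    by (simp add: algebra_simps cis_mult)
  also have "\<dots> = norm (exp (\<i> * of_real (a - b)) - 1)"
    by (simp add: norm_mult cis_conv_exp)
  also have "\<dots> \<le> \<bar>a - b\<bar>"
    using dist_exp_i_1[of "a - b"] abs_sin_le_one abs_sin_x_le_abs_x[of "(a - b) / 2"] by simp
  finally show ?thesis .
qed

text \<open>The angle 2 pi t ranges from (2j - 2) pi / N to 2j pi / N, that of
  \<open>\<zeta>\<close> from (2j - 1) pi / N to (2j + 1) pi / N. The extreme positions are three
  half-steps apart, which is the origin of 3 pi.\<close>

lemma open_arc_dist_le:
  assumes "\<zeta> \<in> open_arc N j" "0 < N" "t \<in> {(real j - 1) / real N..real j / real N}"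
  shows "norm (cis (2 * pi * t) - \<zeta>) \<le> 3 * pi / real N"
proof -
  obtain \<theta> where \<theta>: "\<zeta> = cis \<theta>" "(2 * real j - 1) * pi / real N < \<theta>" "\<theta> < (2 * real j + 1) * pi / real N"
    using assms(1) by (auto simp: open_arc_def)
  define u where "u = pi / real N"
  have "2 * pi * ((real j - 1) / real N) \<le> 2 * pi * t" "2 * pi * t \<le> 2 * pi * (real j / real N)"
    by (rule mult_left_mono; use assms(3) in simp)+
  then have "2 * (real j * u) - 2 * u \<le> 2 * pi * t" "2 * pi * t \<le> 2 * (real j * u)"
    by (simp_all add: u_def algebra_simps diff_divide_distrib)
  moreover have "2 * (real j * u) - u < \<theta>" "\<theta> < 2 * (real j * u) + u"
    using \<theta>(2,3) by (simp_all add: u_def algebra_simps diff_divide_distrib add_divide_distrib)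
  moreover have "3 * pi / real N = 3 * u" "0 < u"
    using assms(2) by (simp_all add: u_def)
  ultimately have "\<bar>2 * pi * t - \<theta>\<bar> \<le> 3 * pi / real N"
    by linarith
  then show ?thesis
    unfolding \<theta>(1) using norm_cis_diff_le[of "2 * pi * t" \<theta>] by linarith
qed

lemma open_arc_norm: "\<zeta> \<in> open_arc N j \<Longrightarrow> norm \<zeta> = 1"
  by (auto simp: open_arc_def)

text \<open>The arcs of integration lag behind \<^const>\<open>open_arc\<close> by half a step, so that they tile \<open>{0..1}\<close>.\<close>

definition arc_integral :: "nat \<Rightarrow> (complex \<Rightarrow> 'a::banach) \<Rightarrow> nat \<Rightarrow> 'a" where
  "arc_integral N \<phi> j = integral {(real j - 1) / real N..real j / real N} (\<lambda>t. \<phi> (cis (2 * pi * t)))"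

lemma sum_arc_integral:
  fixes \<phi> :: "complex \<Rightarrow> 'a::banach"
  assumes "continuous_on (sphere 0 1) \<phi>" "0 < N"
  shows "(\<Sum>j\<in>{1..N}. arc_integral N \<phi> j) = circle_mean \<phi>"
proof -
  have "(\<Sum>j\<in>{1..J}. arc_integral N \<phi> j) = integral {0..real J / real N} (\<lambda>t. \<phi> (cis (2 * pi * t)))" for J
  proof (induction J)
    case (Suc J)
    have "integral {0..real J / real N} (\<lambda>t. \<phi> (cis (2 * pi * t))) + arc_integral N \<phi> (Suc J)
        = integral {0..real (Suc J) / real N} (\<lambda>t. \<phi> (cis (2 * pi * t)))"
      using Henstock_Kurzweil_Integration.integral_combine
        [OF _ _ integrable_cis_comp[OF assms(1)], of 0 "real J / real N" "real (Suc J) / real N"] assms(2)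
      by (simp add: arc_integral_def divide_right_mono)
    then show ?case using Suc.IH by simp
  qed simp
  from this[of N] assms(2) show ?thesis by (simp add: circle_mean_def)
qed

lemma norm_arc_integral_le:
  fixes \<phi> :: "complex \<Rightarrow> 'a::banach"
  assumes "continuous_on (sphere 0 1) \<phi>" "continuous_on (sphere 0 1) \<psi>"
    "\<And>t. t \<in> {(real j - 1) / real N..real j / real N} \<Longrightarrow> norm (\<phi> (cis (2 * pi * t))) \<le> \<psi> (cis (2 * pi * t))"
  shows "norm (arc_integral N \<phi> j) \<le> arc_integral N \<psi> j"
  unfolding arc_integral_def
  by (rule integral_norm_bound_integral) (rule integrable_cis_comp, fact assms | fact assms)+

text \<open>Both denominators are at least 1 - R in modulus, and moving the parameter by half of
  that changes them by at most half, so neither can be more than twice the other.\<close>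

lemma szego_kernel_comparable:
  assumes "norm (a - b) \<le> (1 - R) / 2" "norm a \<le> R" "norm b \<le> R" "R < 1" "norm z \<le> 1"
  shows "norm (szego_kernel b z) \<le> 2 * norm (szego_kernel a z)"
proof -
  let ?A = "norm (1 - cnj a * z)" and ?B = "norm (1 - cnj b * z)"
  have A: "1 - R \<le> ?A" and B: "1 - R \<le> ?B"
    using szego_denominator_ge[OF assms(5), of a] szego_denominator_ge[OF assms(5), of b] assms(2,3) by linarith+
  have "(1 - cnj a * z) - (1 - cnj b * z) = cnj (b - a) * z"
    by (simp add: algebra_simps)
  then have "?A - ?B \<le> norm (a - b) * norm z"
    using norm_triangle_ineq2[of "1 - cnj a * z" "1 - cnj b * z"]
    by (simp add: norm_mult norm_minus_commute del: complex_cnj_diff)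
  also have "\<dots> \<le> (1 - R) / 2 * 1"
    using assms by (intro mult_mono) auto
  finally have "?A \<le> 2 * ?B" using A by simp
  moreover have "1 / y \<le> 2 * (1 / x)" if "0 < x" "0 < y" "x \<le> 2 * y" for x y :: real
    using that by (simp add: field_simps)
  moreover have "0 < ?A" "0 < ?B" using A B assms(4) by linarith+
  ultimately have "1 / ?B \<le> 2 * (1 / ?A)" by blast
  then show ?thesis by (simp add: szego_kernel_def norm_divide)
qed

lemma szego_kernel_jointly_continuous:
  assumes "0 \<le> s" "s < 1" "A \<subseteq> cball 0 1" "B \<subseteq> cball 0 1"
  shows "continuous_on (A \<times> B) (\<lambda>(w, z). szego_kernel (of_real s * w) z)"
proof -
  have "1 - cnj (of_real s * w) * z \<noteq> 0" if "w \<in> A" "z \<in> B" for w z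
  proof (rule szego_denominator_nonzero)
    have "norm w \<le> 1" using that assms by auto
    then have "s * norm w \<le> s" using assms by (simp add: mult_left_le)
    then show "norm (of_real s * w) < 1" unfolding norm_mult norm_of_real abs_of_nonneg[OF assms(1)] using assms by linarith
    show "norm z \<le> 1" using that assms by auto
  qed
  then show ?thesis
    unfolding szego_kernel_def case_prod_beta by (intro continuous_intros) auto
qed

lemma continuous_on_szego_kernel_parameter:
  assumes "0 \<le> s" "s < 1" "norm z \<le> 1"
  shows "continuous_on (sphere 0 1) (\<lambda>w. szego_kernel (of_real s * w) z)"
proof -
  have "continuous_on (sphere 0 1) (\<lambda>w. (\<lambda>(w, z). szego_kernel (of_real s * w) z) (w, z))"
    by (rule continuous_on_compose2[OF szego_kernel_jointly_continuous[OF assms(1,2), of "sphere 0 1" "cball 0 1"]])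
      (use assms in \<open>auto intro!: continuous_intros\<close>)
  then show ?thesis by simp
qed

text \<open>Absolute values inside the sum allow a cut at any \<open>J\<close>. On its arc each
  sampled kernel is at most twice the true one, and the arcs left out contribute nonnegative terms,
  so the bound is a mean over the whole circle.\<close>

lemma szego_sum_bound:
  assumes g: "continuous_on (sphere 0 1) g" and R: "0 < R" "R < 1" and N: "0 < N"
    and d: "3 * pi / real N \<le> (1 - R) / 2"
    and \<zeta>: "\<And>j. j \<in> {1..N} \<Longrightarrow> \<zeta> j \<in> open_arc N j" and z: "norm z \<le> 1" and J: "J \<le> N"
  shows "norm (\<Sum>j\<in>{1..J}. arc_integral N g j * szego_kernel (of_real R * \<zeta> j) z)
    \<le> 2 * circle_mean (\<lambda>w. norm (g w) * norm (szego_kernel (of_real R * w) z))"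
proof -
  let ?\<psi> = "\<lambda>w. norm (g w) * norm (szego_kernel (of_real R * w) z)"
  have ck: "continuous_on (sphere 0 1) (\<lambda>w. szego_kernel (of_real R * w) z)"
    using R z by (intro continuous_on_szego_kernel_parameter) auto
  have c\<psi>: "continuous_on (sphere 0 1) ?\<psi>"
    by (intro continuous_on_mult continuous_on_norm g ck)
  have le: "norm (arc_integral N g j * szego_kernel (of_real R * \<zeta> j) z) \<le> arc_integral N (\<lambda>w. 2 * ?\<psi> w) j"
    if j: "j \<in> {1..N}" for j
  proof -
    let ?k = "szego_kernel (of_real R * \<zeta> j) z"
    have "arc_integral N g j * ?k = arc_integral N (\<lambda>w. g w * ?k) j"
      by (simp add: arc_integral_def)
    also have "norm \<dots> \<le> arc_integral N (\<lambda>w. 2 * ?\<psi> w) j"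
    proof (rule norm_arc_integral_le)
      fix t assume t: "t \<in> {(real j - 1) / real N..real j / real N}"
      let ?w = "cis (2 * pi * t)"
      have "of_real R * ?w - of_real R * \<zeta> j = of_real R * (?w - \<zeta> j)" by (simp add: algebra_simps)
      then have "norm (of_real R * ?w - of_real R * \<zeta> j) = R * norm (?w - \<zeta> j)"
        using R by (simp add: norm_mult)
      also have "\<dots> \<le> norm (?w - \<zeta> j)" using R by (simp add: mult_left_le_one_le)
      also have "\<dots> \<le> (1 - R) / 2" using open_arc_dist_le[OF \<zeta>[OF j] N t] d by linarith
      finally have "norm ?k \<le> 2 * norm (szego_kernel (of_real R * ?w) z)"
        using R z open_arc_norm[OF \<zeta>[OF j]]
        by (intro szego_kernel_comparable[where R = R]) (auto simp: norm_mult)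
      then have "norm (g ?w) * norm ?k \<le> norm (g ?w) * (2 * norm (szego_kernel (of_real R * ?w) z))"
        by (rule mult_left_mono) simp
      then show "norm (g ?w * ?k) \<le> 2 * ?\<psi> ?w" by (simp add: norm_mult mult_ac)
    qed (intro continuous_on_mult continuous_on_const g c\<psi>)+
    finally show ?thesis .
  qed
  have nn: "0 \<le> arc_integral N (\<lambda>w. 2 * ?\<psi> w) j" if "j \<in> {1..N}" for j
    using le[OF that] norm_ge_zero order_trans by blast
  have "norm (\<Sum>j\<in>{1..J}. arc_integral N g j * szego_kernel (of_real R * \<zeta> j) z) \<le>
      (\<Sum>j\<in>{1..J}. arc_integral N (\<lambda>w. 2 * ?\<psi> w) j)"
    using J by (intro sum_norm_le le) auto
  also have "\<dots> \<le> (\<Sum>j\<in>{1..N}. arc_integral N (\<lambda>w. 2 * ?\<psi> w) j)"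
    using J nn by (intro sum_mono2) auto
  also have "\<dots> = circle_mean (\<lambda>w. 2 * ?\<psi> w)"
    by (rule sum_arc_integral[OF continuous_on_mult[OF continuous_on_const c\<psi>] N])
  finally show ?thesis by (simp only: circle_mean_mult_left)
qed

text \<open>For a complete row the arcs tile the circle, and Cauchy's formula at R z is compared
  with the sum arc by arc. The factor 6 pi / N is the distance 3 pi / N times the comparison factor
  2; the resolvent identity gives the square of the kernel.\<close>

lemma szego_sum_approx:
  assumes g: "continuous_on (cball 0 1) g" "g holomorphic_on ball 0 1" and R: "0 < R" "R < 1" and N: "0 < N"
    and d: "3 * pi / real N \<le> (1 - R) / 2"
    and \<zeta>: "\<And>j. j \<in> {1..N} \<Longrightarrow> \<zeta> j \<in> open_arc N j" and z: "norm z \<le> 1"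
  shows "norm ((\<Sum>j\<in>{1..N}. arc_integral N g j * szego_kernel (of_real R * \<zeta> j) z) - g (of_real R * z))
    \<le> 6 * pi / real N * circle_mean (\<lambda>w. norm (g w) * (norm (szego_kernel (of_real R * w) z))\<^sup>2)"
proof -
  let ?\<psi> = "\<lambda>w. norm (g w) * (norm (szego_kernel (of_real R * w) z))\<^sup>2"
  have gs: "continuous_on (sphere 0 1) g" using g(1) by (rule continuous_on_subset) auto
  have ck: "continuous_on (sphere 0 1) (\<lambda>w. szego_kernel (of_real R * w) z)"
    using R z by (intro continuous_on_szego_kernel_parameter) auto
  have c\<psi>: "continuous_on (sphere 0 1) ?\<psi>"
    by (intro continuous_on_mult continuous_on_power continuous_on_norm gs ck)
  have cgk: "continuous_on (sphere 0 1) (\<lambda>w. g w * szego_kernel (of_real R * w) z)"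
    by (intro continuous_on_mult gs ck)
  have "R * norm z \<le> R" using R z by (simp add: mult_left_le)
  then have Rz: "norm (of_real R * z) < 1" unfolding norm_mult norm_of_real abs_of_pos[OF R(1)] using R(2) by linarith
  have "circle_mean (\<lambda>w. g w / (1 - cnj w * (of_real R * z))) = g (of_real R * z)"
    by (rule circle_mean_Cauchy[OF g Rz])
  then have "g (of_real R * z) = circle_mean (\<lambda>w. g w * szego_kernel (of_real R * w) z)"
    by (simp add: szego_kernel_def mult_ac)
  also have "\<dots> = (\<Sum>j\<in>{1..N}. arc_integral N (\<lambda>w. g w * szego_kernel (of_real R * w) z) j)"
    by (rule sum_arc_integral[OF cgk N, symmetric])
  finally have gR: "g (of_real R * z) = \<dots>" .
  have le: "norm (arc_integral N g j * szego_kernel (of_real R * \<zeta> j) z -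
      arc_integral N (\<lambda>w. g w * szego_kernel (of_real R * w) z) j) \<le> arc_integral N (\<lambda>w. 6 * pi / real N * ?\<psi> w) j"
    if j: "j \<in> {1..N}" for j
  proof -
    let ?k = "szego_kernel (of_real R * \<zeta> j) z"
    have "arc_integral N g j * ?k - arc_integral N (\<lambda>w. g w * szego_kernel (of_real R * w) z) j
        = arc_integral N (\<lambda>w. g w * ?k) j - arc_integral N (\<lambda>w. g w * szego_kernel (of_real R * w) z) j"
      by (simp add: arc_integral_def)
    also have "\<dots> = arc_integral N (\<lambda>w. g w * ?k - g w * szego_kernel (of_real R * w) z) j"
      unfolding arc_integral_def
      by (rule integral_diff[symmetric]) (rule integrable_cis_comp, intro continuous_on_mult continuous_on_const gs ck)+
    also have "norm \<dots> \<le> arc_integral N (\<lambda>w. 6 * pi / real N * ?\<psi> w) j"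
    proof (rule norm_arc_integral_le)
      fix t assume t: "t \<in> {(real j - 1) / real N..real j / real N}"
      let ?w = "cis (2 * pi * t)"
      let ?K = "szego_kernel (of_real R * ?w) z"
      have "of_real R * ?w - of_real R * \<zeta> j = of_real R * (?w - \<zeta> j)" by (simp add: algebra_simps)
      then have "norm (of_real R * ?w - of_real R * \<zeta> j) = R * norm (?w - \<zeta> j)"
        using R by (simp add: norm_mult)
      also have "\<dots> \<le> norm (?w - \<zeta> j)" using R by (simp add: mult_left_le_one_le)
      finally have dist: "norm (of_real R * ?w - of_real R * \<zeta> j) \<le> 3 * pi / real N"
        using open_arc_dist_le[OF \<zeta>[OF j] N t] by linarith
      have k: "norm ?k \<le> 2 * norm ?K"
        using R z open_arc_norm[OF \<zeta>[OF j]] dist d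
        by (intro szego_kernel_comparable[where R = R]) (auto simp: norm_mult)
      have "norm (g ?w * ?k - g ?w * ?K) = norm (g ?w) * norm (?K - ?k)"
        by (simp add: norm_mult norm_minus_commute flip: right_diff_distrib)
      also have "\<dots> \<le> norm (g ?w) * (norm (of_real R * ?w - of_real R * \<zeta> j) * (norm ?K * norm ?k))"
        using R z open_arc_norm[OF \<zeta>[OF j]]
        by (intro mult_left_mono norm_szego_kernel_diff_le) (auto simp: norm_mult)
      also have "\<dots> \<le> norm (g ?w) * (3 * pi / real N * (norm ?K * (2 * norm ?K)))"
        using dist k by (intro mult_left_mono mult_mono) auto
      also have "\<dots> = 6 * pi / real N * ?\<psi> ?w"
        by (simp add: power2_eq_square)
      finally show "norm (g ?w * ?k - g ?w * ?K) \<le> 6 * pi / real N * ?\<psi> ?w" .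
    qed (intro continuous_on_mult continuous_on_diff continuous_on_const gs ck c\<psi>)+
    finally show ?thesis .
  qed
  have "norm ((\<Sum>j\<in>{1..N}. arc_integral N g j * szego_kernel (of_real R * \<zeta> j) z) - g (of_real R * z))
      \<le> (\<Sum>j\<in>{1..N}. arc_integral N (\<lambda>w. 6 * pi / real N * ?\<psi> w) j)"
    unfolding gR sum_subtractf[symmetric] by (intro sum_norm_le le)
  also have "\<dots> = circle_mean (\<lambda>w. 6 * pi / real N * ?\<psi> w)"
    by (rule sum_arc_integral[OF continuous_on_mult[OF continuous_on_const c\<psi>] N])
  finally show ?thesis by (simp only: circle_mean_mult_left)
qed

text \<open>The swap of parameter and variable in absolute value moves these means to
  \<open>circle_mean_szego_kernel_le\<close> and its square version. The extra freedom s \<le> R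
  serves the circles of radius t < 1 in H^1, where s = t R.\<close>

lemma circle_mean_szego_parameter_le:
  assumes "0 \<le> s" "s \<le> R" "R < 1" "norm z \<le> 1"
  shows "circle_mean (\<lambda>w. (norm (szego_kernel (of_real s * w) z))\<^sup>2) \<le> 1 / (1 - R)"
    and "(1 / 2) ^ n \<le> 1 - R \<Longrightarrow> circle_mean (\<lambda>w. norm (szego_kernel (of_real s * w) z)) \<le> 1 + real n"
proof -
  have "s * norm z \<le> s" using assms by (simp add: mult_left_le)
  then have n: "norm (of_real s * z) \<le> R" unfolding norm_mult norm_of_real abs_of_nonneg[OF assms(1)] using assms by linarith
  show "circle_mean (\<lambda>w. (norm (szego_kernel (of_real s * w) z))\<^sup>2) \<le> 1 / (1 - R)"
    unfolding norm_szego_kernel_swap[of s _ z]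
    by (rule circle_mean_szego_kernel_square_le[OF n assms(3)])
  show "circle_mean (\<lambda>w. norm (szego_kernel (of_real s * w) z)) \<le> 1 + real n" if "(1 / 2) ^ n \<le> 1 - R"
    unfolding norm_szego_kernel_swap[of s _ z]
    by (rule circle_mean_szego_kernel_le) (use that n assms in linarith)+
qed

section \<open>Positive kernels acting on means\<close>

lemma continuous_on_circle_mean:
  fixes \<Phi> :: "complex \<Rightarrow> complex \<Rightarrow> 'a::banach"
  assumes "continuous_on (U \<times> sphere 0 1) (\<lambda>(z, w). \<Phi> z w)"
  shows "continuous_on U (\<lambda>z. circle_mean (\<Phi> z))"
proof -
  have "continuous_on (U \<times> cbox 0 1) ((\<lambda>(z, w). \<Phi> z w) \<circ> (\<lambda>p::complex \<times> real. (fst p, cis (2 * pi * snd p))))"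
    by (intro continuous_on_compose continuous_on_subset[OF assms] continuous_intros) auto
  then have "continuous_on (U \<times> cbox 0 1) (\<lambda>(z, t::real). \<Phi> z (cis (2 * pi * t)))"
    by (simp add: o_def case_prod_beta)
  from integral_continuous_on_param[OF this] show ?thesis
    by (simp add: circle_mean_def)
qed

text \<open>The L^1 case of the Schur test: after exchanging the means, the bound for the mean in
  the first variable factors out.\<close>

lemma circle_mean_kernel_swap_le:
  fixes g :: "complex \<Rightarrow> real" and K :: "complex \<Rightarrow> complex \<Rightarrow> real"
  assumes g: "continuous_on (sphere 0 1) g" "\<And>w. norm w = 1 \<Longrightarrow> 0 \<le> g w"
    and K: "continuous_on (sphere 0 1 \<times> sphere 0 1) (\<lambda>(z, w). K z w)"
    and B: "\<And>w. norm w = 1 \<Longrightarrow> circle_mean (\<lambda>z. K z w) \<le> B"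
  shows "continuous_on (sphere 0 1) (\<lambda>z. circle_mean (\<lambda>w. g w * K z w))"
    and "circle_mean (\<lambda>z. circle_mean (\<lambda>w. g w * K z w)) \<le> B * circle_mean g"
proof -
  have "continuous_on (sphere 0 1 \<times> sphere 0 1) (\<lambda>p::complex\<times>complex. g (snd p))"
    by (rule continuous_on_compose2[OF g(1)]) (auto intro: continuous_intros)
  then have c: "continuous_on (sphere 0 1 \<times> sphere 0 1) (\<lambda>(z, w). g w * K z w)"
    using K by (auto simp: case_prod_beta intro!: continuous_on_mult)
  then show "continuous_on (sphere 0 1) (\<lambda>z. circle_mean (\<lambda>w. g w * K z w))"
    by (rule continuous_on_circle_mean)
  have "continuous_on (sphere 0 1 \<times> sphere 0 1) ((\<lambda>(z, w). g w * K z w) \<circ> prod.swap)"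
    by (intro continuous_on_compose continuous_on_swap continuous_on_subset[OF c]) auto
  then have c': "continuous_on (sphere 0 1 \<times> sphere 0 1) (\<lambda>(w, z). g w * K z w)"
    by (simp add: o_def case_prod_beta)
  have "circle_mean (\<lambda>z. circle_mean (\<lambda>w. g w * K z w)) = circle_mean (\<lambda>w. g w * circle_mean (\<lambda>z. K z w))"
    by (subst circle_mean_swap[OF c]) (simp only: circle_mean_mult_left)
  also have "\<dots> \<le> circle_mean (\<lambda>w. B * g w)"
  proof (rule circle_mean_mono)
    show "continuous_on (sphere 0 1) (\<lambda>w. g w * circle_mean (\<lambda>z. K z w))"
      using continuous_on_circle_mean[OF c'] by (simp only: circle_mean_mult_left)
    show "continuous_on (sphere 0 1) (\<lambda>w. B * g w)" by (intro continuous_on_mult continuous_on_const g)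
    show "g w * circle_mean (\<lambda>z. K z w) \<le> B * g w" if "norm w = 1" for w
      using mult_left_mono[OF B[OF that] g(2)[OF that]] by (simp add: mult.commute)
  qed
  also have "\<dots> = B * circle_mean g" by (rule circle_mean_mult_left)
  finally show "circle_mean (\<lambda>z. circle_mean (\<lambda>w. g w * K z w)) \<le> B * circle_mean g" .
qed

subsection \<open>Blocks of the lexicographic enumeration\<close>

text \<open>Positions and blocks are counted from 0 but the indices of the system from 1, so block k
  consists of the triples with first component \<open>Suc k\<close>.\<close>

definition block_start :: "(nat \<Rightarrow> nat) \<Rightarrow> (nat \<Rightarrow> nat) \<Rightarrow> nat \<Rightarrow> nat" where
  "block_start N M k = (\<Sum>i<k. M (Suc i) * N (Suc i))"

lemma block_start_Suc: "block_start N M (Suc k) = block_start N M k + M (Suc k) * N (Suc k)"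
  by (simp add: block_start_def)

lemma lex_next_power_j:
  "1 + i \<le> N k \<Longrightarrow> (lex_next N M ^^ i) (k, l, 1) = (k, l, 1 + i)"
  by (induction i) auto

lemma lex_next_power_row:
  assumes "0 < N k"
  shows "(lex_next N M ^^ N k) (k, l, 1) = (if l < M k then (k, Suc l, 1) else (Suc k, 1, 1))"
proof -
  obtain n where n: "N k = Suc n" using assms by (cases "N k") auto
  have "(lex_next N M ^^ n) (k, l, 1) = (k, l, 1 + n)"
    by (rule lex_next_power_j) (simp add: n)
  then show ?thesis by (simp add: n)
qed

lemma lex_next_power_l:
  assumes "0 < N k"
  shows "1 + i \<le> M k \<Longrightarrow> (lex_next N M ^^ (i * N k)) (k, 1, 1) = (k, 1 + i, 1)"
proof (induction i)
  case (Suc i)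
  have "(lex_next N M ^^ (Suc i * N k)) (k, 1, 1) = (lex_next N M ^^ N k) ((lex_next N M ^^ (i * N k)) (k, 1, 1))"
    by (simp add: funpow_add)
  also have "\<dots> = (k, 1 + Suc i, 1)"
    using Suc lex_next_power_row[of N k M "1 + i"] assms by simp
  finally show ?case .
qed simp

lemma lex_enum_block_start:
  assumes "\<And>k. 1 \<le> k \<Longrightarrow> 0 < N k \<and> 0 < M k"
  shows "lex_enum N M (block_start N M k) = (Suc k, 1, 1)"
proof (induction k)
  case 0
  then show ?case by (simp add: block_start_def lex_enum_def)
next
  case (Suc k)
  have pos: "0 < N (Suc k)" "0 < M (Suc k)" using assms by auto
  obtain m where m: "M (Suc k) = Suc m" using pos by (cases "M (Suc k)") auto
  have "block_start N M (Suc k) = N (Suc k) + (m * N (Suc k) + block_start N M k)"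
    by (simp add: block_start_Suc m)
  then have "lex_enum N M (block_start N M (Suc k)) =
      (lex_next N M ^^ N (Suc k)) ((lex_next N M ^^ (m * N (Suc k))) (lex_enum N M (block_start N M k)))"
    by (simp only: lex_enum_def funpow_add o_apply)
  also have "\<dots> = (lex_next N M ^^ N (Suc k)) (Suc k, 1 + m, 1)"
    unfolding Suc.IH using lex_next_power_l[of N "Suc k" m M] pos m by simp
  also have "\<dots> = (Suc (Suc k), 1, 1)"
    by (subst lex_next_power_row) (use pos m in auto)
  finally show ?case .
qed

lemma lex_enum_block:
  assumes "\<And>k. 1 \<le> k \<Longrightarrow> 0 < N k \<and> 0 < M k" "l < M (Suc k)" "j < N (Suc k)"
  shows "lex_enum N M (block_start N M k + l * N (Suc k) + j) = (Suc k, Suc l, Suc j)"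
proof -
  have start: "lex_enum N M (block_start N M k) = (Suc k, 1, 1)"
    by (rule lex_enum_block_start) (rule assms(1))
  \<comment> \<open>Reversed because the rightmost summand of an exponent is iterated first.\<close>
  have "block_start N M k + l * N (Suc k) + j = j + (l * N (Suc k) + block_start N M k)" by simp
  then have "lex_enum N M (block_start N M k + l * N (Suc k) + j) =
      (lex_next N M ^^ j) ((lex_next N M ^^ (l * N (Suc k))) (lex_enum N M (block_start N M k)))"
    by (simp only: lex_enum_def funpow_add o_apply)
  also have "\<dots> = (lex_next N M ^^ j) (Suc k, 1 + l, 1)"
    unfolding start using lex_next_power_l[of N "Suc k" l M] assms by simp
  also have "\<dots> = (Suc k, 1 + l, 1 + j)"
    by (rule lex_next_power_j) (use assms in simp)
  finally show ?thesis by simp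
qed

lemma sum_rows:
  fixes f :: "nat \<Rightarrow> 'a::comm_monoid_add"
  shows "sum f {a..<a + L * N + J} = (\<Sum>l<L. \<Sum>j<N. f (a + l * N + j)) + (\<Sum>j<J. f (a + L * N + j))"
proof -
  have shift: "sum f {b..<b + n} = (\<Sum>j<n. f (b + j))" for b n
    by (induction n) (auto simp: add.commute)
  have "sum f {a..<a + L * N} = (\<Sum>l<L. \<Sum>j<N. f (a + l * N + j))"
  proof (induction L)
    case (Suc L)
    have "sum f {a..<a + Suc L * N} = sum f {a..<a + L * N} + sum f {a + L * N..<a + L * N + N}"
      by (subst sum.atLeastLessThan_concat) (auto simp: add_ac)
    then show ?case unfolding Suc.IH sum.lessThan_Suc by (simp only: shift)
  qed simp
  moreover have "sum f {a..<a + L * N + J} = sum f {a..<a + L * N} + sum f {a + L * N..<a + L * N + J}"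
    by (subst sum.atLeastLessThan_concat) auto
  ultimately show ?thesis by (simp add: shift)
qed

subsection \<open>Greedy expansions\<close>

text \<open>Elements are total functions of which only the values in the disk matter, so the norm is
  merely a seminorm on them. Sums over blocks are handled with these rules for both spaces at
  once.\<close>

locale seminormed_function_space =
  fixes X :: "(complex \<Rightarrow> complex) set" and nrm :: "(complex \<Rightarrow> complex) \<Rightarrow> real"
  assumes zero_in: "(\<lambda>_. 0) \<in> X"
    and add_in: "f \<in> X \<Longrightarrow> g \<in> X \<Longrightarrow> (\<lambda>z. f z + g z) \<in> X"
    and scale_in: "f \<in> X \<Longrightarrow> (\<lambda>z. a * f z) \<in> X"
    and norm_nonneg: "f \<in> X \<Longrightarrow> 0 \<le> nrm f"
    and norm_add: "f \<in> X \<Longrightarrow> g \<in> X \<Longrightarrow> nrm (\<lambda>z. f z + g z) \<le> nrm f + nrm g"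
    and norm_scale: "f \<in> X \<Longrightarrow> nrm (\<lambda>z. a * f z) \<le> norm a * nrm f"
begin

lemma norm_zero: "nrm (\<lambda>_. 0) = 0"
  using norm_scale[OF zero_in, of 0] norm_nonneg[OF zero_in] by simp

lemma diff_in: "f \<in> X \<Longrightarrow> g \<in> X \<Longrightarrow> (\<lambda>z. f z - g z) \<in> X"
  using add_in[OF _ scale_in[of g "-1"]] by simp

lemma norm_diff: "f \<in> X \<Longrightarrow> g \<in> X \<Longrightarrow> nrm (\<lambda>z. f z - g z) \<le> nrm f + nrm g"
  using norm_add[OF _ scale_in[of g "-1"], of f] norm_scale[of g "-1"] by simp

lemma sum_in: "(\<And>i. i \<in> I \<Longrightarrow> f i \<in> X) \<Longrightarrow> (\<lambda>z. \<Sum>i\<in>I. f i z) \<in> X"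
  by (induction I rule: infinite_finite_induct) (auto intro: zero_in add_in)

lemma norm_sum: "(\<And>i. i \<in> I \<Longrightarrow> f i \<in> X) \<Longrightarrow> nrm (\<lambda>z. \<Sum>i\<in>I. f i z) \<le> (\<Sum>i\<in>I. nrm (f i))"
proof (induction I rule: infinite_finite_induct)
  case (insert i I)
  have "nrm (\<lambda>z. f i z + (\<Sum>i\<in>I. f i z)) \<le> nrm (f i) + nrm (\<lambda>z. \<Sum>i\<in>I. f i z)"
    using insert.prems by (intro norm_add sum_in) auto
  with insert show ?case by fastforce
qed (auto simp: norm_zero)

text \<open>Blocks are passed over until one is good for the current remainder; it is then spent on
  that remainder. Since the partial sums inside a block are at most K times the current bound, the
  error never exceeds (1 + K) times that bound, even in the middle of a block.\<close>

lemma representing_system_greedy: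
  fixes x :: "nat \<Rightarrow> complex \<Rightarrow> complex" and S :: "nat \<Rightarrow> nat" and K :: real
  assumes x: "\<And>n. x n \<in> X" and S: "strict_mono S" "S 0 = 0" and K: "0 \<le> K"
    and step: "\<And>f b. f \<in> X \<Longrightarrow> nrm f \<le> b \<Longrightarrow> 0 < b \<Longrightarrow> \<exists>k0. \<forall>k\<ge>k0. \<exists>c :: nat \<Rightarrow> complex.
      nrm (\<lambda>z. f z - (\<Sum>n\<in>{S k..<S (Suc k)}. c n * x n z)) \<le> 3 / 4 * b \<and>
      (\<forall>m\<in>{S k..S (Suc k)}. nrm (\<lambda>z. \<Sum>n\<in>{S k..<m}. c n * x n z) \<le> K * b)"
  shows "representing_system X nrm x"
proof -
  define good where "good f b k c \<longleftrightarrow>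
      nrm (\<lambda>z. f z - (\<Sum>n\<in>{S k..<S (Suc k)}. c n * x n z)) \<le> 3 / 4 * b \<and>
      (\<forall>m\<in>{S k..S (Suc k)}. nrm (\<lambda>z. \<Sum>n\<in>{S k..<m}. c n * x n z) \<le> K * b)" for f b k and c :: "nat \<Rightarrow> complex"
  have psum_in: "(\<lambda>z. \<Sum>n\<in>A. c n * x n z) \<in> X" for A and c :: "nat \<Rightarrow> complex"
    by (intro sum_in scale_in x)
  have "\<exists>C. (\<lambda>m. nrm (\<lambda>z. f z - (\<Sum>n<m. C n * x n z))) \<longlonglongrightarrow> 0" if f: "f \<in> X" for f
  proof -
    \<comment> \<open>Zero coefficients on a block that does not help leave the remainder
      unchanged.\<close>
    define sel where "sel h b k = (if \<exists>c. good h b k c then (SOME c. good h b k c) else (\<lambda>_. 0))" for h b k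
    \<comment> \<open>The state carries a bound beside the remainder, since \<open>step\<close>
      demands a positive one even when the remainder has norm 0; for the same reason it starts at
      \<open>nrm f + 1\<close>.\<close>
    define st where "st = rec_nat (f, nrm f + 1) (\<lambda>k (h, b).
      ((\<lambda>z. h z - (\<Sum>n\<in>{S k..<S (Suc k)}. sel h b k n * x n z)), if \<exists>c. good h b k c then 3 / 4 * b else b))"
    define h where "h k = fst (st k)" for k
    define b where "b k = snd (st k)" for k
    define c where "c k = sel (h k) (b k) k" for k
    have stS: "st (Suc k) = (\<lambda>(h, b). ((\<lambda>z. h z - (\<Sum>n\<in>{S k..<S (Suc k)}. sel h b k n * x n z)),
        if \<exists>c. good h b k c then 3 / 4 * b else b)) (st k)" for k
      by (simp only: st_def nat.rec)
    have h0: "h 0 = f" and b0: "b 0 = nrm f + 1" by (simp_all add: h_def b_def st_def)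
    have hS: "h (Suc k) = (\<lambda>z. h k z - (\<Sum>n\<in>{S k..<S (Suc k)}. c k n * x n z))"
      and bS: "b (Suc k) = (if \<exists>c. good (h k) (b k) k c then 3 / 4 * b k else b k)" for k
      unfolding h_def b_def c_def stS by (simp_all only: case_prod_beta fst_conv snd_conv)
    have bpos: "0 < b k" for k
      by (induction k) (use norm_nonneg[OF f] in \<open>auto simp: b0 bS\<close>)
    have good: "good (h k) (b k) k (c k)" if "\<exists>c. good (h k) (b k) k c" for k
      unfolding c_def sel_def using that someI_ex[OF that] by simp
    have c0: "c k = (\<lambda>_. 0)" if "\<nexists>c. good (h k) (b k) k c" for k
      unfolding c_def sel_def by (rule if_not_P[OF that])
    have hX: "h k \<in> X" for k
      by (induction k) (auto simp: h0 hS f intro: diff_in psum_in)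
    have hb: "nrm (h k) \<le> b k" for k
    proof (induction k)
      case (Suc k)
      show ?case
      proof (cases "\<exists>c. good (h k) (b k) k c")
        case True
        then show ?thesis using good[OF True] by (simp add: hS bS good_def)
      next
        case False
        then show ?thesis using Suc.IH by (simp add: hS bS c0)
      qed
    qed (simp add: h0 b0)
    have part: "nrm (\<lambda>z. \<Sum>n\<in>{S k..<m}. c k n * x n z) \<le> K * b k" if "m \<in> {S k..S (Suc k)}" for k m
    proof (cases "\<exists>c. good (h k) (b k) k c")
      case True
      then show ?thesis using good[OF True] that by (simp add: good_def)
    next
      case False
      then show ?thesis using K bpos[of k] by (simp add: c0 norm_zero)
    qed
    have anti: "b (Suc k) \<le> b k" for k
      using bpos[of k] by (simp add: bS)
    then have decr: "b k \<le> b i" if "i \<le> k" for i k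
      using that by (rule lift_Suc_antimono_le)
    \<comment> \<open>While no block is good the state is frozen, so \<open>step\<close> applies to
      one fixed pair and supplies a good block after finitely many. No single block is guaranteed to
      lower the bound.\<close>
    have drop: "\<exists>k. b k \<le> 3 / 4 * b i" for i
    proof (rule ccontr)
      assume *: "\<nexists>k. b k \<le> 3 / 4 * b i"
      have const: "h (i + d) = h i \<and> b (i + d) = b i" for d
      proof (induction d)
        case (Suc d)
        have "\<nexists>c. good (h (i + d)) (b (i + d)) (i + d) c"
        proof
          assume "\<exists>c. good (h (i + d)) (b (i + d)) (i + d) c"
          then have "b (Suc (i + d)) = 3 / 4 * b i" using Suc.IH by (simp add: bS)
          then show False using * by (metis order_refl)
        qed
        then show ?case using Suc.IH by (simp add: hS bS c0)
      qed simp
      obtain k0 where k0: "\<And>k. k \<ge> k0 \<Longrightarrow> \<exists>c. good (h i) (b i) k c"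
        unfolding good_def using step[OF hX hb bpos, of i] by blast
      have "\<exists>c. good (h (i + k0)) (b (i + k0)) (i + k0) c"
        using k0[of "i + k0"] const[of k0] by simp
      then have "b (Suc (i + k0)) = 3 / 4 * b i" using const[of k0] by (simp add: bS)
      then show False using * by (metis order_refl)
    qed
    have pow: "\<exists>k. b k \<le> (3 / 4) ^ i * b 0" for i
    proof (induction i)
      case (Suc i)
      then obtain k where "b k \<le> (3 / 4) ^ i * b 0" by blast
      moreover obtain k' where "b k' \<le> 3 / 4 * b k" using drop by blast
      ultimately show ?case by (intro exI[of _ k']) simp
    qed auto
    have blim: "b \<longlonglongrightarrow> 0"
    proof (rule LIMSEQ_I)
      fix e :: real assume e: "0 < e"
      have "(\<lambda>i. (3 / 4) ^ i * b 0) \<longlonglongrightarrow> 0 * b 0"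
        by (intro tendsto_mult LIMSEQ_realpow_zero tendsto_const) auto
      then have "\<forall>\<^sub>F i in sequentially. (3 / 4) ^ i * b 0 < e"
        using e by (intro order_tendstoD(2)) auto
      then obtain i where "(3 / 4) ^ i * b 0 < e" by (auto dest: eventually_happens)
      moreover obtain k where "b k \<le> (3 / 4) ^ i * b 0" using pow by blast
      ultimately have k: "b k < e" by simp
      show "\<exists>no. \<forall>n\<ge>no. norm (b n - 0) < e"
      proof (intro exI[of _ k] allI impI)
        fix n assume "k \<le> n"
        then have "b n \<le> b k" by (rule decr)
        then show "norm (b n - 0) < e" using k bpos[of n] by simp
      qed
    qed
    \<comment> \<open>The block containing position n; it glues the coefficients chosen block by
      block into one sequence.\<close>
    define blk where "blk n = (LEAST k. n < S (Suc k))" for n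
    have ge: "n \<le> S n" for n using S(1) by (rule strict_mono_imp_increasing)
    have blk_eq: "blk n = k" if "S k \<le> n" "n < S (Suc k)" for n k
      unfolding blk_def
    proof (rule Least_equality)
      fix y assume "n < S (Suc y)"
      then have "S k < S (Suc y)" using that by simp
      then show "k \<le> y" using S(1) by (simp add: strict_mono_less)
    qed (rule that)
    have blk: "S (blk n) \<le> n" "n < S (Suc (blk n))" for n
    proof -
      have "n < S (Suc n)" using ge[of "Suc n"] by simp
      then show "n < S (Suc (blk n))" unfolding blk_def by (rule LeastI)
      show "S (blk n) \<le> n"
      proof (cases "blk n")
        case 0
        then show ?thesis using S(2) by simp
      next
        case (Suc k)
        then show ?thesis using not_less_Least[of k "\<lambda>k. n < S (Suc k)"] by (auto simp: blk_def)
      qed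
    qed
    define C where "C n = c (blk n) n" for n
    have C: "(\<Sum>n\<in>{S k..<m}. C n * x n z) = (\<Sum>n\<in>{S k..<m}. c k n * x n z)" if "m \<le> S (Suc k)" for k m z
      by (rule sum.cong) (use that blk_eq in \<open>auto simp: C_def\<close>)
    have hC: "h k z = f z - (\<Sum>n<S k. C n * x n z)" for k z
    proof (induction k)
      case (Suc k)
      have "{..<S (Suc k)} = {..<S k} \<union> {S k..<S (Suc k)}"
        using strict_monoD[OF S(1), of k "Suc k"] by auto
      then have "(\<Sum>n<S (Suc k). C n * x n z) = (\<Sum>n<S k. C n * x n z) + (\<Sum>n\<in>{S k..<S (Suc k)}. C n * x n z)"
        by (simp add: sum.union_disjoint ivl_disj_int)
      then show ?case using Suc.IH by (simp add: hS C)
    qed (simp add: h0 S)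
    \<comment> \<open>The error at m is the remainder at the start of the current block minus the
      part of that block already summed.\<close>
    have bound: "nrm (\<lambda>z. f z - (\<Sum>n<m. C n * x n z)) \<le> (1 + K) * b (blk m)" for m
    proof -
      let ?k = "blk m"
      have "{..<m} = {..<S ?k} \<union> {S ?k..<m}" using blk[of m] by auto
      then have "(\<Sum>n<m. C n * x n z) = (\<Sum>n<S ?k. C n * x n z) + (\<Sum>n\<in>{S ?k..<m}. C n * x n z)" for z
        by (simp add: sum.union_disjoint ivl_disj_int)
      then have "(\<lambda>z. f z - (\<Sum>n<m. C n * x n z)) = (\<lambda>z. h ?k z - (\<Sum>n\<in>{S ?k..<m}. c ?k n * x n z))"
        using C[of m ?k] blk[of m] by (simp add: hC diff_diff_eq)
      moreover have "nrm (\<lambda>z. h ?k z - (\<Sum>n\<in>{S ?k..<m}. c ?k n * x n z)) \<le> b ?k + K * b ?k"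
        using norm_diff[OF hX[of ?k] psum_in[of "c ?k" "{S ?k..<m}"]] hb[of ?k] part[of m ?k] blk[of m] by simp
      ultimately show ?thesis by (simp add: algebra_simps)
    qed
    have "filterlim blk at_top sequentially"
      unfolding filterlim_at_top
    proof
      fix Z
      show "\<forall>\<^sub>F n in sequentially. Z \<le> blk n"
        using eventually_ge_at_top[of "S Z"]
      proof eventually_elim
        case (elim n)
        then have "S Z < S (Suc (blk n))" using blk(2)[of n] by simp
        then show ?case using S(1) by (simp add: strict_mono_less)
      qed
    qed
    then have "(\<lambda>m. (1 + K) * b (blk m)) \<longlonglongrightarrow> (1 + K) * 0"
      by (intro tendsto_mult tendsto_const filterlim_compose[OF blim])
    then have lim: "(\<lambda>m. (1 + K) * b (blk m)) \<longlonglongrightarrow> 0" by simp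
    have "(\<lambda>m. nrm (\<lambda>z. f z - (\<Sum>n<m. C n * x n z))) \<longlonglongrightarrow> 0"
      by (rule tendsto_sandwich[OF _ _ tendsto_const lim])
        (auto intro!: always_eventually norm_nonneg diff_in f psum_in bound)
    then show ?thesis by blast
  qed
  then show ?thesis unfolding representing_system_def using x by blast
qed

end

text \<open>The number n of halvings that reach 1 - R controls the mean of the kernel. The growth
  condition is turned into the statement that n is at most a fixed multiple of the number of
  rows.\<close>

lemma logarithmic_depth:
  assumes R: "\<And>k. 1 \<le> k \<Longrightarrow> 0 < R k \<and> R k < 1" and M: "\<And>k. 1 \<le> k \<Longrightarrow> 0 < M k"
    and O: "(\<lambda>k. ln (1 / (1 - R k))) \<in> O(\<lambda>k. real (M k))"
  obtains K where "0 \<le> K" "\<forall>\<^sub>F k in sequentially. \<exists>n::nat. (1 / 2) ^ n \<le> 1 - R k \<and> 1 + real n \<le> K * real (M k)"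
proof -
  obtain a where a: "0 < a" "\<forall>\<^sub>F k in sequentially. norm (ln (1 / (1 - R k))) \<le> a * norm (real (M k))"
    using O by (elim landau_o.bigE)
  \<comment> \<open>Rounding up gives 1 + n \<le> 2 + log_2 (1 / (1 - R)); the 2 is absorbed by M
    \<ge> 1, and \<open>a / ln 2\<close> is the growth constant in base 2.\<close>
  have "\<forall>\<^sub>F k in sequentially. \<exists>n::nat. (1 / 2) ^ n \<le> 1 - R k \<and> 1 + real n \<le> (2 + a / ln 2) * real (M k)"
    using a(2) eventually_ge_at_top[of 1]
  proof eventually_elim
    case (elim k)
    define n where "n = nat \<lceil>log 2 (1 / (1 - R k))\<rceil>"
    have k: "0 < R k" "R k < 1" "1 \<le> real (M k)"
      using R[OF elim(2)] M[OF elim(2)] by auto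
    have l0: "0 \<le> log 2 (1 / (1 - R k))" using k by simp
    have n: "log 2 (1 / (1 - R k)) \<le> real n" "real n \<le> 1 + log 2 (1 / (1 - R k))"
      unfolding n_def using l0 by linarith+
    have "1 / (1 - R k) = 2 powr log 2 (1 / (1 - R k))" using k by simp
    also have "\<dots> \<le> 2 powr real n" using n(1) by (intro powr_mono) auto
    also have "\<dots> = 2 ^ n" by (simp add: powr_realpow)
    finally have "1 / 2 ^ n \<le> 1 - R k" using k by (simp add: field_simps)
    then have 1: "(1 / 2) ^ n \<le> 1 - R k" by (simp add: power_one_over)
    have "log 2 (1 / (1 - R k)) \<le> a * real (M k) / ln 2"
      unfolding log_def using elim(1) by (intro divide_right_mono) auto
    then have "1 + real n \<le> 2 * 1 + a / ln 2 * real (M k)" using n(2) by simp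
    also have "\<dots> \<le> 2 * real (M k) + a / ln 2 * real (M k)" using k by simp
    finally show ?case using 1 by (auto simp: algebra_simps)
  qed
  then show ?thesis using that[of "2 + a / ln 2"] a(1) by simp
qed

subsection \<open>Representing systems of Szego kernels\<close>

text \<open>The discretized Cauchy integral cut after J arcs. The weights do not involve
  \<open>\<zeta>\<close>, so all rows of a block share them.\<close>

definition szego_sum :: "nat \<Rightarrow> real \<Rightarrow> (nat \<Rightarrow> complex) \<Rightarrow> (complex \<Rightarrow> complex) \<Rightarrow> nat \<Rightarrow> complex \<Rightarrow> complex" where
  "szego_sum N R \<zeta> g J z = (\<Sum>j\<in>{1..J}. arc_integral N g j * szego_kernel (of_real R * \<zeta> j) z)"

definition arc_points :: "nat \<Rightarrow> real \<Rightarrow> (nat \<Rightarrow> complex) \<Rightarrow> bool" where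
  "arc_points N R \<zeta> \<longleftrightarrow> 0 < R \<and> R < 1 \<and> 0 < N \<and> 12 * pi \<le> real N * (1 - R) \<and>
     (\<forall>j\<in>{1..N}. \<zeta> j \<in> open_arc N j)"

text \<open>The first inequality makes sampled and true kernels comparable, for which 6 pi would do.
  The second turns 6 pi / N times the square mean 1 / (1 - R) into an error factor 1/2; this is the
  origin of 12 pi.\<close>

lemma arc_pointsD:
  assumes "arc_points N R \<zeta>"
  shows "3 * pi / real N \<le> (1 - R) / 2" "6 * pi / real N * (1 / (1 - R)) \<le> 1 / 2"
proof -
  have a: "0 < R" "R < 1" "0 < real N" "12 * pi \<le> real N * (1 - R)"
    using assms by (auto simp: arc_points_def)
  have "6 * pi \<le> real N * (1 - R)"
    using a(4) pi_gt_zero by linarith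
  then show "3 * pi / real N \<le> (1 - R) / 2"
    using a(3) by (simp add: field_simps)
  have "6 * pi / (real N * (1 - R)) \<le> 1 / 2"
    using a by (subst divide_le_eq) auto
  then show "6 * pi / real N * (1 / (1 - R)) \<le> 1 / 2" by simp
qed

lemma szego_sum_holomorphic:
  assumes "arc_points N R \<zeta>" "J \<le> N"
  shows "continuous_on (cball 0 1) (szego_sum N R \<zeta> g J)" "szego_sum N R \<zeta> g J holomorphic_on ball 0 1"
proof -
  have "szego_kernel (of_real R * \<zeta> j) holomorphic_on cball 0 1" if "j \<in> {1..J}" for j
    using assms that open_arc_norm[of "\<zeta> j" N j]
    by (intro holomorphic_szego_kernel) (auto simp: arc_points_def norm_mult)
  then have "szego_sum N R \<zeta> g J holomorphic_on cball 0 1"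
    unfolding szego_sum_def by (intro holomorphic_on_sum holomorphic_on_mult holomorphic_on_const)
  then show "continuous_on (cball 0 1) (szego_sum N R \<zeta> g J)" "szego_sum N R \<zeta> g J holomorphic_on ball 0 1"
    by (auto intro: holomorphic_on_imp_continuous_on holomorphic_on_subset)
qed

text \<open>Exactly what the block construction asks of a space. The row estimates concern f(rz),
  which is defined on the circle, but are bounded by the norm of f, so r may be chosen depending on
  f without affecting any constant.\<close>

locale szego_sum_space = seminormed_function_space +
  assumes bounded_in: "continuous_on (cball 0 1) f \<Longrightarrow> f holomorphic_on ball 0 1 \<Longrightarrow> f \<in> X"
    and norm_bounded: "continuous_on (cball 0 1) f \<Longrightarrow> f holomorphic_on ball 0 1 \<Longrightarrow>
      (\<And>z. norm z \<le> 1 \<Longrightarrow> norm (f z) \<le> B) \<Longrightarrow> nrm f \<le> B"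
    and in_holomorphic: "f \<in> X \<Longrightarrow> f holomorphic_on ball 0 1"
    and norm_dilate: "f \<in> X \<Longrightarrow> 0 < r \<Longrightarrow> r < 1 \<Longrightarrow> nrm (\<lambda>z. f (of_real r * z)) \<le> nrm f"
    and dilation_dense: "f \<in> X \<Longrightarrow> 0 < e \<Longrightarrow> \<exists>r. 0 < r \<and> r < 1 \<and> nrm (\<lambda>z. f z - f (of_real r * z)) \<le> e"
    and norm_szego_sum: "f \<in> X \<Longrightarrow> 0 < r \<Longrightarrow> r < 1 \<Longrightarrow> arc_points N R \<zeta> \<Longrightarrow> J \<le> N \<Longrightarrow> (1 / 2) ^ n \<le> 1 - R \<Longrightarrow>
      nrm (szego_sum N R \<zeta> (\<lambda>z. f (of_real r * z)) J) \<le> 2 * (1 + real n) * nrm f"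
    and norm_szego_sum_approx: "f \<in> X \<Longrightarrow> 0 < r \<Longrightarrow> r < 1 \<Longrightarrow> arc_points N R \<zeta> \<Longrightarrow>
      nrm (\<lambda>z. szego_sum N R \<zeta> (\<lambda>z. f (of_real r * z)) N z - f (of_real r * (of_real R * z))) \<le> 1 / 2 * nrm f"
begin

lemma dilate:
  assumes "f \<in> X" "0 < r" "r < 1"
  shows "continuous_on (cball 0 1) (\<lambda>z. f (of_real r * z))" "(\<lambda>z. f (of_real r * z)) holomorphic_on ball 0 1"
    "(\<lambda>z. f (of_real r * z)) \<in> X"
proof -
  have f: "f holomorphic_on ball 0 1" by (rule in_holomorphic[OF assms(1)])
  show c: "continuous_on (cball 0 1) (\<lambda>z. f (of_real r * z))"
    by (rule continuous_on_dilate[OF holomorphic_on_imp_continuous_on[OF f]]) (use assms in auto)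
  show h: "(\<lambda>z. f (of_real r * z)) holomorphic_on ball 0 1"
    by (rule holomorphic_dilate[OF f]) (use assms in auto)
  show "(\<lambda>z. f (of_real r * z)) \<in> X" by (rule bounded_in[OF c h])
qed

text \<open>Averaging over the \<open>M\<close> rows divides the logarithmic norm of an incomplete row by \<open>M\<close>,
  while complete rows are uniformly bounded.\<close>

lemma averaged_block:
  fixes \<zeta> :: "nat \<Rightarrow> nat \<Rightarrow> complex"
  assumes f: "f \<in> X" "nrm f \<le> b" and b: "0 < b"
    and r: "0 < r" "r < 1" "nrm (\<lambda>z. f z - f (of_real r * z)) \<le> b / 8"
    and R: "nrm (\<lambda>z. f (of_real r * z) - f (of_real r * (of_real R * z))) \<le> b / 8"
    and arc: "\<And>l. l < M \<Longrightarrow> arc_points N R (\<zeta> l)" and M: "0 < M"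
    and n: "(1 / 2) ^ n \<le> 1 - R" "1 + real n \<le> K * real M"
  shows "nrm (\<lambda>z. f z - (\<Sum>l<M. inverse (of_nat M) * szego_sum N R (\<zeta> l) (\<lambda>z. f (of_real r * z)) N z)) \<le> 3 / 4 * b"
    and "L \<le> M \<Longrightarrow> J \<le> N \<Longrightarrow> J = 0 \<or> L < M \<Longrightarrow>
      nrm (\<lambda>z. (\<Sum>l<L. inverse (of_nat M) * szego_sum N R (\<zeta> l) (\<lambda>z. f (of_real r * z)) N z)
        + inverse (of_nat M) * szego_sum N R (\<zeta> L) (\<lambda>z. f (of_real r * z)) J z) \<le> (3 / 2 + 2 * K) * b"
proof -
  let ?g = "\<lambda>z. f (of_real r * z)"
  let ?T = "\<lambda>l. szego_sum N R (\<zeta> l) ?g"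
  have R01: "0 < R" "R < 1" using arc[OF M] by (auto simp: arc_points_def)
  have m: "norm (inverse (of_nat M :: complex)) = 1 / real M" by (simp add: norm_inverse divide_inverse)
  have TX: "?T l J \<in> X" if "l < M" "J \<le> N" for l J
    by (intro bounded_in szego_sum_holomorphic arc that)
  have gX: "?g \<in> X" by (rule dilate[OF f(1) r(1,2)])
  have gRX: "(\<lambda>z. ?g (of_real R * z)) \<in> X" by (rule dilate(3)[OF gX R01])
  have app: "nrm (\<lambda>z. ?T l N z - ?g (of_real R * z)) \<le> b / 2" if "l < M" for l
    using norm_szego_sum_approx[OF f(1) r(1,2) arc[OF that]] f(2) by simp
  have gR: "nrm (\<lambda>z. ?g (of_real R * z)) \<le> b"
    using norm_dilate[OF gX R01] norm_dilate[OF f(1) r(1,2)] f(2) by linarith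
  \<comment> \<open>A complete row is within b / 2 of a dilate of f, whose norm is at most b; no
    logarithm enters.\<close>
  have full: "nrm (?T l N) \<le> 3 / 2 * b" if "l < M" for l
  proof -
    have "nrm (\<lambda>z. (?T l N z - ?g (of_real R * z)) + ?g (of_real R * z)) \<le> b / 2 + b"
      using norm_add[OF diff_in[OF TX[OF that order_refl] gRX] gRX] app[OF that] gR by linarith
    then show ?thesis by simp
  qed
  show "nrm (\<lambda>z. f z - (\<Sum>l<M. inverse (of_nat M) * ?T l N z)) \<le> 3 / 4 * b"
  proof -
    have sX: "(\<lambda>z. \<Sum>l<M. inverse (of_nat M) * (?T l N z - ?g (of_real R * z))) \<in> X"
      by (intro sum_in scale_in diff_in TX gRX) auto
    have "nrm (\<lambda>z. \<Sum>l<M. inverse (of_nat M) * (?T l N z - ?g (of_real R * z))) \<le>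
        (\<Sum>l<M. nrm (\<lambda>z. inverse (of_nat M) * (?T l N z - ?g (of_real R * z))))"
      by (intro norm_sum scale_in diff_in TX gRX) auto
    also have "\<dots> \<le> (\<Sum>l<M. 1 / real M * (b / 2))"
    proof (rule sum_mono)
      fix l assume "l \<in> {..<M}"
      then have l: "l < M" by simp
      show "nrm (\<lambda>z. inverse (of_nat M) * (?T l N z - ?g (of_real R * z))) \<le> 1 / real M * (b / 2)"
        using norm_scale[OF diff_in[OF TX[OF l order_refl] gRX], of "inverse (of_nat M)"]
          mult_left_mono[OF app[OF l], of "1 / real M"] unfolding m by simp
    qed
    also have "\<dots> = b / 2" using M by simp
    finally have s: "nrm (\<lambda>z. \<Sum>l<M. inverse (of_nat M) * (?T l N z - ?g (of_real R * z))) \<le> b / 2" .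
    \<comment> \<open>The three errors: dilation by r, dilation by R, and the averaged
      discretization. They are at most b / 8, b / 8 and b / 2, whence the contraction factor
      3/4.\<close>
    have dec: "f z - (\<Sum>l<M. inverse (of_nat M) * ?T l N z) = ((f z - ?g z) + (?g z - ?g (of_real R * z)))
        - (\<Sum>l<M. inverse (of_nat M) * (?T l N z - ?g (of_real R * z)))" for z
    proof -
      have "(\<Sum>l<M. inverse (of_nat M) * (?T l N z - ?g (of_real R * z))) =
          (\<Sum>l<M. inverse (of_nat M) * ?T l N z) - (\<Sum>l<M. inverse (of_nat M) * ?g (of_real R * z))"
        by (simp only: right_diff_distrib sum_subtractf)
      also have "(\<Sum>l<M. inverse (of_nat M) * ?g (of_real R * z)) = ?g (of_real R * z)"
        using M by simp
      finally show ?thesis by (simp only:) simp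
    qed
    have "nrm (\<lambda>z. f z - (\<Sum>l<M. inverse (of_nat M) * ?T l N z)) \<le>
        nrm (\<lambda>z. (f z - ?g z) + (?g z - ?g (of_real R * z)))
        + nrm (\<lambda>z. \<Sum>l<M. inverse (of_nat M) * (?T l N z - ?g (of_real R * z)))"
      unfolding dec by (rule norm_diff[OF add_in[OF diff_in[OF f(1) gX] diff_in[OF gX gRX]] sX])
    also have "\<dots> \<le> (b / 8 + b / 8) + b / 2"
      using norm_add[OF diff_in[OF f(1) gX] diff_in[OF gX gRX]] r(3) R s by linarith
    also have "\<dots> = 3 / 4 * b" by simp
    finally show ?thesis .
  qed
  show "nrm (\<lambda>z. (\<Sum>l<L. inverse (of_nat M) * ?T l N z) + inverse (of_nat M) * ?T L J z) \<le> (3 / 2 + 2 * K) * b"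
    if L: "L \<le> M" and J: "J \<le> N" "J = 0 \<or> L < M"
  proof -
    have K: "0 \<le> K * b"
    proof -
      have "0 \<le> K * real M" using n(2) by linarith
      then show ?thesis using M b by (simp add: zero_le_mult_iff)
    qed
    have last: "(\<lambda>z. inverse (of_nat M) * ?T L J z) \<in> X \<and> nrm (\<lambda>z. inverse (of_nat M) * ?T L J z) \<le> 2 * K * b"
    \<comment> \<open>At the end of the block L = M, and there is no row L to speak of; the cut row
      is then empty.\<close>
    proof (cases "J = 0")
      case True
      then show ?thesis using zero_in norm_zero K by (simp add: szego_sum_def)
    next
      case False
      then have LM: "L < M" using J by simp
      have "nrm (\<lambda>z. inverse (of_nat M) * ?T L J z) \<le> 1 / real M * nrm (?T L J)"
        using norm_scale[OF TX[OF LM J(1)], of "inverse (of_nat M)"] unfolding m .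
      also have "\<dots> \<le> 1 / real M * (2 * (1 + real n) * b)"
      proof (rule mult_left_mono)
        have "2 * (1 + real n) * nrm f \<le> 2 * (1 + real n) * b"
          using f(2) by (intro mult_left_mono) auto
        then show "nrm (?T L J) \<le> 2 * (1 + real n) * b"
          using norm_szego_sum[OF f(1) r(1,2) arc[OF LM] J(1) n(1)] by linarith
      qed simp
      \<comment> \<open>The factor 1 / M cancels the logarithmic size 1 + n \<le> K M of the single
        cut row.\<close>
      also have "\<dots> \<le> 1 / real M * (2 * (K * real M) * b)"
        using n(2) b by (intro mult_left_mono mult_right_mono) auto
      also have "\<dots> = 2 * K * b" using M by simp
      finally show ?thesis using scale_in[OF TX[OF LM J(1)]] by blast
    qed
    have sX: "(\<lambda>z. \<Sum>l<L. inverse (of_nat M) * ?T l N z) \<in> X"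
      using L by (intro sum_in scale_in TX) auto
    have "nrm (\<lambda>z. \<Sum>l<L. inverse (of_nat M) * ?T l N z) \<le> (\<Sum>l<L. nrm (\<lambda>z. inverse (of_nat M) * ?T l N z))"
      using L by (intro norm_sum scale_in TX) auto
    also have "\<dots> \<le> (\<Sum>l<L. 1 / real M * (3 / 2 * b))"
    proof (rule sum_mono)
      fix l assume "l \<in> {..<L}"
      then have l: "l < M" using L by simp
      show "nrm (\<lambda>z. inverse (of_nat M) * ?T l N z) \<le> 1 / real M * (3 / 2 * b)"
        using norm_scale[OF TX[OF l order_refl], of "inverse (of_nat M)"]
          mult_left_mono[OF full[OF l], of "1 / real M"] unfolding m by simp
    qed
    also have "\<dots> = real L / real M * (3 / 2 * b)" by simp
    also have "\<dots> \<le> 1 * (3 / 2 * b)"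
      using L M b by (intro mult_right_mono) auto
    finally show ?thesis
      using norm_add[OF sX conjunct1[OF last]] conjunct2[OF last] by (simp add: algebra_simps)
  qed
qed

text \<open>Combines the averaged rows with the greedy expansion: every position inside a block
  consists of L complete rows and one row cut after J terms, as \<open>averaged_block\<close>
  requires.\<close>

lemma representing_system_szego_kernels:
  fixes R :: "nat \<Rightarrow> real" and N M :: "nat \<Rightarrow> nat" and \<zeta> :: "nat \<Rightarrow> nat \<Rightarrow> nat \<Rightarrow> complex"
  assumes R: "\<And>k. 1 \<le> k \<Longrightarrow> 0 < R k \<and> R k < 1" and lim: "R \<longlonglongrightarrow> 1"
    and pos: "\<And>k. 1 \<le> k \<Longrightarrow> 0 < N k \<and> 0 < M k"
    and \<zeta>: "\<And>k j l. 1 \<le> k \<Longrightarrow> j \<in> {1..N k} \<Longrightarrow> l \<in> {1..M k} \<Longrightarrow> \<zeta> k l j \<in> open_arc (N k) j"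
    and NR: "\<And>k. 1 \<le> k \<Longrightarrow> 12 * pi \<le> real (N k) * (1 - R k)"
    and O: "(\<lambda>k. ln (1 / (1 - R k))) \<in> O(\<lambda>k. real (M k))"
  shows "representing_system X nrm
    (\<lambda>n. case lex_enum N M n of (k, l, j) \<Rightarrow> szego_kernel (of_real (R k) * \<zeta> k l j))"
proof -
  define x where "x n = (case lex_enum N M n of (k, l, j) \<Rightarrow> szego_kernel (of_real (R k) * \<zeta> k l j))" for n
  define S where "S = block_start N M"
  obtain K where K: "0 \<le> K" "\<forall>\<^sub>F k in sequentially. \<exists>n::nat. (1 / 2) ^ n \<le> 1 - R k \<and> 1 + real n \<le> K * real (M k)"
    using logarithmic_depth[OF R conjunct2[OF pos] O] by blast
  have arc: "arc_points (N (Suc k)) (R (Suc k)) (\<zeta> (Suc k) (Suc l))" if "l < M (Suc k)" for k l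
    unfolding arc_points_def using R[of "Suc k"] pos[of "Suc k"] NR[of "Suc k"] \<zeta>[of "Suc k" _ "Suc l"] that by auto
  have xX: "x n \<in> X" for n
  proof -
    have "lex_enum N M n \<in> triple_index N M"
      using bij_betwE[OF lex_enum_bij_betw[of N M]] pos by blast
    then obtain k l j where klj: "lex_enum N M n = (k, l, j)" "1 \<le> k" "l \<in> {1..M k}" "j \<in> {1..N k}"
      by (auto simp: triple_index_def)
    then have "norm (of_real (R k) * \<zeta> k l j) < 1"
      using R[of k] open_arc_norm[OF \<zeta>[of k j l]] by (simp add: norm_mult)
    then show ?thesis
      using holomorphic_szego_kernel[of "of_real (R k) * \<zeta> k l j"]
      by (auto simp: x_def klj(1) intro!: bounded_in continuous_on_szego_kernel intro: holomorphic_on_subset)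
  qed
  have "representing_system X nrm x"
  proof (rule representing_system_greedy[where S = S and K = "3 / 2 + 2 * K"])
    show "strict_mono S"
      using pos by (auto simp: strict_mono_Suc_iff S_def block_start_Suc)
    show "S 0 = 0" by (simp add: S_def block_start_def)
    show "0 \<le> 3 / 2 + 2 * K" using K(1) by simp
    show "x n \<in> X" for n by (rule xX)
    fix f :: "complex \<Rightarrow> complex" and b :: real
    assume f: "f \<in> X" "nrm f \<le> b" and b: "0 < b"
    \<comment> \<open>The radius r is fixed first, so that f(rz) is uniformly continuous; only then
      can k be taken so large that the dilation by R k hardly changes it.\<close>
    obtain r where r: "0 < r" "r < 1" "nrm (\<lambda>z. f z - f (of_real r * z)) \<le> b / 8"
      using dilation_dense[OF f(1), of "b / 8"] b by auto
    let ?g = "\<lambda>z. f (of_real r * z)"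
    note g = dilate[OF f(1) r(1,2)]
    \<comment> \<open>Only eventually, because the indices start at 1 and \<open>R 0\<close> is
      arbitrary.\<close>
    have "\<forall>\<^sub>F k in sequentially. \<bar>R k\<bar> \<le> 1"
      using eventually_ge_at_top[of 1] by eventually_elim (use R in force)
    then have "\<forall>\<^sub>F k in sequentially. \<forall>z\<in>cball 0 1. dist (?g (of_real (R k) * z)) (?g z) < b / 8"
      using uniform_limitD[OF uniform_limit_dilation[OF g(1) lim], of "b / 8"] b by simp
    with K(2) have "\<forall>\<^sub>F k in sequentially. (\<exists>n::nat. (1 / 2) ^ n \<le> 1 - R k \<and> 1 + real n \<le> K * real (M k)) \<and>
        (\<forall>z\<in>cball 0 1. dist (?g (of_real (R k) * z)) (?g z) < b / 8)"
      by (rule eventually_conj)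
    then obtain k0 where k0: "\<And>k. k0 \<le> k \<Longrightarrow> \<exists>n::nat. (1 / 2) ^ n \<le> 1 - R k \<and> 1 + real n \<le> K * real (M k)"
      "\<And>k z. k0 \<le> k \<Longrightarrow> z \<in> cball 0 1 \<Longrightarrow> dist (?g (of_real (R k) * z)) (?g z) < b / 8"
      unfolding eventually_sequentially by blast
    show "\<exists>k0. \<forall>k\<ge>k0. \<exists>c :: nat \<Rightarrow> complex.
      nrm (\<lambda>z. f z - (\<Sum>n\<in>{S k..<S (Suc k)}. c n * x n z)) \<le> 3 / 4 * b \<and>
      (\<forall>m\<in>{S k..S (Suc k)}. nrm (\<lambda>z. \<Sum>n\<in>{S k..<m}. c n * x n z) \<le> (3 / 2 + 2 * K) * b)"
    proof (intro exI[of _ k0] allI impI)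
      fix k assume k: "k0 \<le> k"
      define N' where "N' = N (Suc k)"
      define M' where "M' = M (Suc k)"
      define R' where "R' = R (Suc k)"
      define T where "T l = szego_sum N' R' (\<zeta> (Suc k) (Suc l)) ?g" for l
      have p: "0 < N'" "0 < M'" "0 < R'" "R' < 1"
        using pos[of "Suc k"] R[of "Suc k"] by (auto simp: N'_def M'_def R'_def)
      obtain n where n: "(1 / 2) ^ n \<le> 1 - R'" "1 + real n \<le> K * real M'"
        using k0(1)[of "Suc k"] k by (auto simp: R'_def M'_def)
      have gR: "nrm (\<lambda>z. ?g z - ?g (of_real R' * z)) \<le> b / 8"
      proof (rule norm_bounded)
        show "norm (?g z - ?g (of_real R' * z)) \<le> b / 8" if "norm z \<le> 1" for z
          using k0(2)[of "Suc k" z] that k by (simp add: R'_def dist_norm norm_minus_commute)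
      qed (intro continuous_on_diff holomorphic_on_diff g dilate(1,2)[OF g(3) p(3,4)])+
      note block = averaged_block[of f b r R' M' N' "\<lambda>l. \<zeta> (Suc k) (Suc l)", OF f b r gR _ p(2) n]
      have arc': "arc_points N' R' (\<zeta> (Suc k) (Suc l))" if "l < M'" for l
        using arc[of l k] that by (simp add: N'_def R'_def M'_def)
      \<comment> \<open>A coefficient depends only on the column, the offset in the block modulo the
        row length; \<open>Suc\<close> passes to columns counted from 1.\<close>
      define c where "c i = inverse (of_nat M') * arc_integral N' ?g (Suc ((i - S k) mod N'))" for i
      have entry: "c (S k + l * N' + j) * x (S k + l * N' + j) z =
          inverse (of_nat M') * (arc_integral N' ?g (Suc j) * szego_kernel (of_real R' * \<zeta> (Suc k) (Suc l) (Suc j)) z)"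
        if "l < M'" "j < N'" for l j z
      proof -
        have "lex_enum N M (S k + l * N' + j) = (Suc k, Suc l, Suc j)"
          unfolding S_def N'_def by (rule lex_enum_block[OF pos]) (use that in \<open>auto simp: N'_def M'_def\<close>)
        then show ?thesis using that by (simp add: c_def x_def R'_def)
      qed
      have row: "(\<Sum>j<J. c (S k + l * N' + j) * x (S k + l * N' + j) z) = inverse (of_nat M') * T l J z"
        if "J = 0 \<or> l < M'" "J \<le> N'" for l J z
      proof -
        have "(\<Sum>j<J. c (S k + l * N' + j) * x (S k + l * N' + j) z) =
            (\<Sum>j<J. inverse (of_nat M') * (arc_integral N' ?g (Suc j) * szego_kernel (of_real R' * \<zeta> (Suc k) (Suc l) (Suc j)) z))"
          by (rule sum.cong) (use that entry in auto)
        also have "\<dots> = inverse (of_nat M') * T l J z"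
          unfolding T_def szego_sum_def sum_distrib_left[symmetric]
          by (simp add: sum.atLeast1_atMost_eq)
        finally show ?thesis .
      qed
      have part: "(\<Sum>i\<in>{S k..<S k + L * N' + J}. c i * x i z) =
          (\<Sum>l<L. inverse (of_nat M') * T l N' z) + inverse (of_nat M') * T L J z"
        if "L \<le> M'" "J \<le> N'" "J = 0 \<or> L < M'" for L J z
        unfolding sum_rows using that by (simp add: row)
      have SS: "S (Suc k) = S k + M' * N'"
        by (simp add: S_def block_start_Suc M'_def N'_def)
      have full: "(\<Sum>i\<in>{S k..<S (Suc k)}. c i * x i z) = (\<Sum>l<M'. inverse (of_nat M') * T l N' z)" for z
        using part[of M' 0 z] by (simp add: SS T_def szego_sum_def)
      have "nrm (\<lambda>z. \<Sum>i\<in>{S k..<m}. c i * x i z) \<le> (3 / 2 + 2 * K) * b" if m: "m \<in> {S k..S (Suc k)}" for m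
      proof -
        define L where "L = (m - S k) div N'"
        define J where "J = (m - S k) mod N'"
        have mLJ: "m = S k + L * N' + J"
          using m by (simp add: L_def J_def)
        have J: "J < N'" using p by (simp add: J_def)
        have LJ: "L * N' + J \<le> M' * N'" using m mLJ SS by simp
        then have "L * N' \<le> M' * N'" by (rule add_leD1)
        then have L: "L \<le> M'" using p(1) by (rule mult_right_le_imp_le)
        \<comment> \<open>If all M' rows are complete, the block has no positions left, so J =
          0.\<close>
        have JL: "J = 0 \<or> L < M'" using LJ L by (cases "L = M'") auto
        show ?thesis
          unfolding mLJ using part[OF L less_imp_le[OF J] JL] block(2)[OF arc' L less_imp_le[OF J] JL]
          by (simp add: T_def)
      qed
      moreover have "nrm (\<lambda>z. f z - (\<Sum>i\<in>{S k..<S (Suc k)}. c i * x i z)) \<le> 3 / 4 * b"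
        using block(1)[OF arc'] by (simp add: full T_def)
      ultimately show "\<exists>c :: nat \<Rightarrow> complex.
          nrm (\<lambda>z. f z - (\<Sum>n\<in>{S k..<S (Suc k)}. c n * x n z)) \<le> 3 / 4 * b \<and>
          (\<forall>m\<in>{S k..S (Suc k)}. nrm (\<lambda>z. \<Sum>n\<in>{S k..<m}. c n * x n z) \<le> (3 / 2 + 2 * K) * b)"
        by blast
    qed
  qed
  then show ?thesis unfolding x_def .
qed

end

subsection \<open>The Hardy space\<close>

lemma H1_continuous_on_dilate:
  assumes "f \<in> H1_space" "0 < r" "r < 1"
  shows "continuous_on (sphere 0 1) (\<lambda>z. f (of_real r * z))"
  by (rule continuous_on_dilate[OF holomorphic_on_imp_continuous_on[OF H1_space_holomorphic[OF assms(1)]]])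
    (use assms in auto)

lemma H1_circle_mean_le:
  assumes "f \<in> H1_space" "0 < r" "r < 1"
  shows "circle_mean (\<lambda>z. norm (f (of_real r * z))) \<le> H1_norm f"
  using hardy_mean_le_H1_norm[OF assms] hardy_mean_holomorphic[OF H1_space_holomorphic[OF assms(1)], of r] assms
  by simp

lemma H1_space_add:
  assumes f: "f \<in> H1_space" and g: "g \<in> H1_space"
  shows "(\<lambda>z. f z + g z) \<in> H1_space" "H1_norm (\<lambda>z. f z + g z) \<le> H1_norm f + H1_norm g"
proof -
  have "circle_mean (\<lambda>z. norm (f (of_real r * z) + g (of_real r * z))) \<le> H1_norm f + H1_norm g" if r: "0 < r" "r < 1" for r
  proof -
    note c = H1_continuous_on_dilate[OF f r] H1_continuous_on_dilate[OF g r]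
    have "circle_mean (\<lambda>z. norm (f (of_real r * z) + g (of_real r * z))) \<le>
        circle_mean (\<lambda>z. norm (f (of_real r * z)) + norm (g (of_real r * z)))"
      by (intro circle_mean_mono continuous_on_norm continuous_on_add c norm_triangle_ineq)
    also have "\<dots> = circle_mean (\<lambda>z. norm (f (of_real r * z))) + circle_mean (\<lambda>z. norm (g (of_real r * z)))"
      by (intro circle_mean_add continuous_on_norm c)
    finally show ?thesis
      using H1_circle_mean_le[OF f r] H1_circle_mean_le[OF g r] by linarith
  qed
  moreover have "(\<lambda>z. f z + g z) holomorphic_on ball 0 1"
    by (intro holomorphic_on_add H1_space_holomorphic f g)
  ultimately show "(\<lambda>z. f z + g z) \<in> H1_space" "H1_norm (\<lambda>z. f z + g z) \<le> H1_norm f + H1_norm g"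
    by (auto intro: H1_spaceI)
qed

lemma H1_space_scale:
  assumes f: "f \<in> H1_space"
  shows "(\<lambda>z. a * f z) \<in> H1_space" "H1_norm (\<lambda>z. a * f z) \<le> norm a * H1_norm f"
proof -
  have "circle_mean (\<lambda>z. norm (a * f (of_real r * z))) \<le> norm a * H1_norm f" if r: "0 < r" "r < 1" for r
    unfolding norm_mult circle_mean_mult_left by (intro mult_left_mono H1_circle_mean_le f r) simp
  moreover have "(\<lambda>z. a * f z) holomorphic_on ball 0 1"
    by (intro holomorphic_on_mult holomorphic_on_const H1_space_holomorphic f)
  ultimately show "(\<lambda>z. a * f z) \<in> H1_space" "H1_norm (\<lambda>z. a * f z) \<le> norm a * H1_norm f"
    by (auto intro: H1_spaceI)
qed

lemma H1_bounded:
  assumes c: "continuous_on (cball 0 1) f" and h: "f holomorphic_on ball 0 1"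
    and B: "\<And>z. norm z \<le> 1 \<Longrightarrow> norm (f z) \<le> B"
  shows "f \<in> H1_space" "H1_norm f \<le> B"
proof -
  have "circle_mean (\<lambda>z. norm (f (of_real r * z))) \<le> B" if r: "0 < r" "r < 1" for r
  proof -
    have "circle_mean (\<lambda>z. norm (f (of_real r * z))) \<le> circle_mean (\<lambda>_. B)"
      using r
      by (intro circle_mean_mono continuous_on_norm continuous_on_const B
          continuous_on_dilate[OF holomorphic_on_imp_continuous_on[OF h]])
        (auto simp: norm_mult)
    then show ?thesis by simp
  qed
  with h show "f \<in> H1_space" "H1_norm f \<le> B" by (auto intro: H1_spaceI)
qed

lemma continuous_cball_bounded:
  fixes f :: "complex \<Rightarrow> complex"
  assumes "continuous_on (cball 0 1) f"
  obtains B where "\<And>z. norm z \<le> 1 \<Longrightarrow> norm (f z) \<le> B"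
proof -
  have "bounded (f ` cball 0 1)"
    by (intro compact_imp_bounded compact_continuous_image assms) simp
  then obtain B where "\<forall>y\<in>f ` cball 0 1. norm y \<le> B" by (auto simp: bounded_iff)
  then show ?thesis by (intro that[of B]) simp
qed

section \<open>From pointwise kernel bounds to bounds in H^1\<close>

lemma norm_szego_kernel_power_jointly_continuous:
  assumes "0 \<le> s" "s < 1"
  shows "continuous_on (sphere 0 1 \<times> sphere 0 1) (\<lambda>(z, w). norm (szego_kernel (of_real s * z) w) ^ i)"
  using continuous_on_power[OF continuous_on_norm[OF szego_kernel_jointly_continuous[OF assms, of "sphere 0 1" "sphere 0 1"]]]
  by (simp add: case_prod_beta)

text \<open>The exponent covers both row estimates: i = 1 for rows cut anywhere, i = 2 for the
  discretization error of a complete row.\<close>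

lemma circle_mean_kernel_mean_le:
  assumes g: "continuous_on (sphere 0 1) g" and F: "continuous_on (sphere 0 1) F" and A: "0 \<le> A"
    and s: "0 \<le> s" "s < 1"
    and le: "\<And>z. norm z = 1 \<Longrightarrow> norm (F z) \<le> A * circle_mean (\<lambda>w. norm (g w) * norm (szego_kernel (of_real s * z) w) ^ i)"
    and B: "\<And>w. norm w = 1 \<Longrightarrow> circle_mean (\<lambda>z. norm (szego_kernel (of_real s * z) w) ^ i) \<le> B"
  shows "circle_mean (\<lambda>z. norm (F z)) \<le> A * (B * circle_mean (\<lambda>w. norm (g w)))"
proof -
  note K = circle_mean_kernel_swap_le[OF continuous_on_norm[OF g] norm_ge_zero
      norm_szego_kernel_power_jointly_continuous[OF s] B]
  have "circle_mean (\<lambda>z. norm (F z)) \<le>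
      circle_mean (\<lambda>z. A * circle_mean (\<lambda>w. norm (g w) * norm (szego_kernel (of_real s * z) w) ^ i))"
    by (intro circle_mean_mono continuous_on_norm F continuous_on_mult_left K(1) le) auto
  also have "\<dots> \<le> A * (B * circle_mean (\<lambda>w. norm (g w)))"
    unfolding circle_mean_mult_left by (intro mult_left_mono K(2) A) auto
  finally show ?thesis .
qed

text \<open>The radius of the evaluation point is moved into the parameter before exchanging the
  roles, so circles inside the disk need no separate kernel estimates.\<close>

lemma norm_szego_kernel_dilate_swap:
  "norm (szego_kernel (of_real R * w) (of_real r * z)) = norm (szego_kernel (of_real (r * R) * z) w)"
proof -
  have "szego_kernel (of_real R * w) (of_real r * z) = szego_kernel (of_real (r * R) * w) z"
    by (simp add: szego_kernel_dilate mult.assoc)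
  then show ?thesis by (simp only: norm_szego_kernel_swap[of "r * R" w z])
qed

text \<open>The row estimates hold pointwise at t z. Taking the mean over z and exchanging means
  leaves a kernel mean with parameter radius t R \<le> R, bounded uniformly in t, times the mean of
  |f(rw)|, which is at most the norm of f; the supremum over t follows.\<close>

interpretation H1: szego_sum_space H1_space H1_norm
proof
  show zero: "(\<lambda>_. 0) \<in> H1_space"
    by (rule H1_bounded[of _ 0]) auto
  fix f assume f: "f \<in> H1_space"
  then show "0 \<le> H1_norm f" by (rule H1_norm_nonneg)
  show "f holomorphic_on ball 0 1" using f by (rule H1_space_holomorphic)
  note hf = this
  show "(\<lambda>z. a * f z) \<in> H1_space" "H1_norm (\<lambda>z. a * f z) \<le> norm a * H1_norm f" for a
    using H1_space_scale[OF f] by auto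
  show "(\<lambda>z. f z + g z) \<in> H1_space" "H1_norm (\<lambda>z. f z + g z) \<le> H1_norm f + H1_norm g" if "g \<in> H1_space" for g
    using H1_space_add[OF f that] by auto
  show "\<exists>r. 0 < r \<and> r < 1 \<and> H1_norm (\<lambda>z. f z - f (of_real r * z)) \<le> e" if "0 < e" for e
    using H1_dilation_dense[OF f that] by metis
  fix r :: real assume r: "0 < r" "r < 1"
  have cg: "continuous_on (cball 0 1) (\<lambda>z. f (of_real r * z))"
    by (rule continuous_on_dilate[OF holomorphic_on_imp_continuous_on[OF hf]]) (use r in auto)
  have hg: "(\<lambda>z. f (of_real r * z)) holomorphic_on ball 0 1"
    by (rule holomorphic_dilate[OF hf]) (use r in auto)
  have cgs: "continuous_on (sphere 0 1) (\<lambda>z. f (of_real r * z))"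
    by (rule H1_continuous_on_dilate[OF f r])
  note mg = H1_circle_mean_le[OF f r]
  show "H1_norm (\<lambda>z. f (of_real r * z)) \<le> H1_norm f"
  proof (rule H1_spaceI(2)[OF hg])
    fix t :: real assume t: "0 < t" "t < 1"
    then have "r * t < 1" using r mult_left_le_one_le[of t r] by linarith
    then show "circle_mean (\<lambda>z. norm (f (of_real r * (of_real t * z)))) \<le> H1_norm f"
      using H1_circle_mean_le[OF f, of "r * t"] r t by (simp add: mult.assoc)
  qed
  fix N R \<zeta> assume arc: "arc_points N R \<zeta>"
  have R: "0 < R" "R < 1" "0 < N" "\<And>j. j \<in> {1..N} \<Longrightarrow> \<zeta> j \<in> open_arc N j" using arc by (auto simp: arc_points_def)
  have tR: "0 \<le> t * R" "t * R < 1" "t * R \<le> R" if "0 < t" "t < 1" for t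
  proof -
    show "t * R \<le> R" using R that by (intro mult_left_le_one_le) auto
    then show "t * R < 1" using R by linarith
    show "0 \<le> t * R" using R that by simp
  qed
  have ct: "continuous_on (sphere 0 1) (\<lambda>z. F (of_real t * z))"
    if "continuous_on (cball 0 1) F" "0 < t" "t < 1" for F :: "complex \<Rightarrow> complex" and t
    by (rule continuous_on_compose2[OF that(1)]) (use that in \<open>auto intro!: continuous_intros simp: norm_mult\<close>)
  show "H1_norm (szego_sum N R \<zeta> (\<lambda>z. f (of_real r * z)) J) \<le> 2 * (1 + real n) * H1_norm f"
    if J: "J \<le> N" and n: "(1 / 2) ^ n \<le> 1 - R" for J n
  proof (rule H1_spaceI(2)[OF szego_sum_holomorphic(2)[OF arc J]])
    fix t :: real assume t: "0 < t" "t < 1"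
    have "circle_mean (\<lambda>z. norm (szego_sum N R \<zeta> (\<lambda>z. f (of_real r * z)) J (of_real t * z))) \<le>
        2 * ((1 + real n) * circle_mean (\<lambda>w. norm (f (of_real r * w))))"
    proof (rule circle_mean_kernel_mean_le[where i = 1, OF cgs ct[OF szego_sum_holomorphic(1)[OF arc J] t] _ tR(1,2)[OF t]])
      fix z :: complex assume z: "norm z = 1"
      then have "norm (of_real t * z) \<le> 1" using t by (simp add: norm_mult)
      from szego_sum_bound[OF cgs R(1-3) arc_pointsD(1)[OF arc] R(4) this J]
      show "norm (szego_sum N R \<zeta> (\<lambda>z. f (of_real r * z)) J (of_real t * z)) \<le>
          2 * circle_mean (\<lambda>w. norm (f (of_real r * w)) * norm (szego_kernel (of_real (t * R) * z) w) ^ 1)"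
        unfolding szego_sum_def norm_szego_kernel_dilate_swap power_one_right by simp
    next
      fix w :: complex assume w: "norm w = 1"
      then show "circle_mean (\<lambda>z. norm (szego_kernel (of_real (t * R) * z) w) ^ 1) \<le> 1 + real n"
        unfolding power_one_right using circle_mean_szego_parameter_le(2)[OF tR(1,3)[OF t] R(2), of w n] n by simp
    qed simp
    also have "\<dots> \<le> 2 * ((1 + real n) * H1_norm f)"
      using mg by (intro mult_left_mono) auto
    finally show "circle_mean (\<lambda>z. norm (szego_sum N R \<zeta> (\<lambda>z. f (of_real r * z)) J (of_real t * z))) \<le>
        2 * (1 + real n) * H1_norm f" by (simp only: mult.assoc)
  qed
  let ?D = "\<lambda>z. szego_sum N R \<zeta> (\<lambda>z. f (of_real r * z)) N z - f (of_real r * (of_real R * z))"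
  have cD: "continuous_on (cball 0 1) ?D" and hD: "?D holomorphic_on ball 0 1"
  proof -
    have hR: "(\<lambda>z. f (of_real r * (of_real R * z))) holomorphic_on ball 0 1"
      by (rule holomorphic_dilate[OF hg]) (use R in auto)
    have cR: "continuous_on (cball 0 1) (\<lambda>z. f (of_real r * (of_real R * z)))"
      by (rule continuous_on_dilate[OF holomorphic_on_imp_continuous_on[OF hg]]) (use R in auto)
    show "continuous_on (cball 0 1) ?D" "?D holomorphic_on ball 0 1"
      by (intro continuous_on_diff holomorphic_on_diff szego_sum_holomorphic[OF arc] order_refl hR cR)+
  qed
  show "H1_norm ?D \<le> 1 / 2 * H1_norm f"
  proof (rule H1_spaceI(2)[OF hD])
    fix t :: real assume t: "0 < t" "t < 1"
    have "circle_mean (\<lambda>z. norm (?D (of_real t * z))) \<le>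
        6 * pi / real N * (1 / (1 - R) * circle_mean (\<lambda>w. norm (f (of_real r * w))))"
    proof (rule circle_mean_kernel_mean_le[where i = 2, OF cgs ct[OF cD t] _ tR(1,2)[OF t]])
      fix z :: complex assume z: "norm z = 1"
      then have "norm (of_real t * z) \<le> 1" using t by (simp add: norm_mult)
      from szego_sum_approx[OF cg hg R(1-3) arc_pointsD(1)[OF arc] R(4) this]
      show "norm (?D (of_real t * z)) \<le>
          6 * pi / real N * circle_mean (\<lambda>w. norm (f (of_real r * w)) * (norm (szego_kernel (of_real (t * R) * z) w))\<^sup>2)"
        unfolding szego_sum_def norm_szego_kernel_dilate_swap by simp
    next
      fix w :: complex assume w: "norm w = 1"
      then show "circle_mean (\<lambda>z. (norm (szego_kernel (of_real (t * R) * z) w))\<^sup>2) \<le> 1 / (1 - R)"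
        by (intro circle_mean_szego_parameter_le(1)[OF tR(1,3)[OF t] R(2)]) simp
    qed simp
    also have "\<dots> = 6 * pi / real N * (1 / (1 - R)) * circle_mean (\<lambda>w. norm (f (of_real r * w)))"
      by (simp only: mult.assoc)
    also have "\<dots> \<le> 1 / 2 * H1_norm f"
      using mg arc_pointsD(2)[OF arc] circle_mean_nonneg[OF continuous_on_norm[OF cgs] norm_ge_zero]
      by (intro mult_mono) auto
    finally show "circle_mean (\<lambda>z. norm (?D (of_real t * z))) \<le> 1 / 2 * H1_norm f" .
  qed
next
  fix f :: "complex \<Rightarrow> complex" and B :: real
  assume c: "continuous_on (cball 0 1) f" and h: "f holomorphic_on ball 0 1"
  obtain B' where "\<And>z. norm z \<le> 1 \<Longrightarrow> norm (f z) \<le> B'"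
    using continuous_cball_bounded[OF c] by metis
  then show "f \<in> H1_space" by (rule H1_bounded(1)[OF c h])
  show "H1_norm f \<le> B" if "\<And>z. norm z \<le> 1 \<Longrightarrow> norm (f z) \<le> B"
    by (rule H1_bounded(2)[OF c h that])
qed

subsection \<open>The disk algebra\<close>

lemma disk_norm_le:
  assumes "\<And>z. norm z \<le> 1 \<Longrightarrow> norm (f z) \<le> B"
  shows "disk_norm f \<le> B"
  unfolding disk_norm_def by (rule cSUP_least) (use assms in auto)

lemma norm_le_disk_norm:
  assumes "f \<in> disk_algebra" "norm z \<le> 1"
  shows "norm (f z) \<le> disk_norm f"
proof -
  obtain B where "\<And>z. norm z \<le> 1 \<Longrightarrow> norm (f z) \<le> B"
    using continuous_cball_bounded[of f] assms(1) by (auto simp: disk_algebra_def)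
  then have "bdd_above ((\<lambda>z. norm (f z)) ` cball 0 1)"
    by (intro bdd_aboveI2[of _ _ B]) auto
  then show ?thesis
    unfolding disk_norm_def using assms(2) by (intro cSUP_upper) auto
qed

text \<open>Here f leaves the mean by its sup-norm, and a kernel mean over the parameter remains. It
  obeys the same bounds as in H^1, so the constants coincide; density of dilates is uniform
  continuity on the closed disk.\<close>

interpretation disk: szego_sum_space disk_algebra disk_norm
proof
  show "(\<lambda>_. 0) \<in> disk_algebra" by (simp add: disk_algebra_def)
  fix f assume f: "f \<in> disk_algebra"
  then have cf: "continuous_on (cball 0 1) f" and hf: "f holomorphic_on ball 0 1"
    by (auto simp: disk_algebra_def)
  note le = norm_le_disk_norm[OF f]
  show nn: "0 \<le> disk_norm f" using order_trans[OF norm_ge_zero le[of 0]] by simp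
  show "f holomorphic_on ball 0 1" by (rule hf)
  show "(\<lambda>z. a * f z) \<in> disk_algebra" for a
    using cf hf by (auto simp: disk_algebra_def intro!: continuous_intros holomorphic_intros)
  show "disk_norm (\<lambda>z. a * f z) \<le> norm a * disk_norm f" for a
    by (rule disk_norm_le) (simp add: norm_mult mult_left_mono le)
  show "(\<lambda>z. f z + g z) \<in> disk_algebra" if "g \<in> disk_algebra" for g
    using cf hf that by (auto simp: disk_algebra_def intro!: continuous_intros holomorphic_intros)
  show "disk_norm (\<lambda>z. f z + g z) \<le> disk_norm f + disk_norm g" if "g \<in> disk_algebra" for g
    by (rule disk_norm_le) (intro norm_triangle_mono le norm_le_disk_norm that)
  show "\<exists>r. 0 < r \<and> r < 1 \<and> disk_norm (\<lambda>z. f z - f (of_real r * z)) \<le> e" if e: "0 < e" for e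
  proof -
    have "uniform_limit (cball 0 1) (\<lambda>n z. f (of_real (1 - 1 / (real n + 2)) * z)) f sequentially"
      by (rule uniform_limit_dilation[OF cf tendsto_one_minus_inverse]) (auto simp: abs_if field_simps)
    then have "\<forall>\<^sub>F n in sequentially. \<forall>z\<in>cball 0 1. dist (f (of_real (1 - 1 / (real n + 2)) * z)) (f z) < e"
      using e by (rule uniform_limitD)
    then obtain n where "\<forall>z\<in>cball 0 1. dist (f (of_real (1 - 1 / (real n + 2)) * z)) (f z) < e"
      using eventually_happens' by (metis (no_types, lifting) sequentially_bot)
    then have n: "dist (f (of_real (1 - 1 / (real n + 2)) * z)) (f z) < e" if "norm z \<le> 1" for z
      using that by simp
    show ?thesis
    proof (intro exI[of _ "1 - 1 / (real n + 2)"] conjI disk_norm_le)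
      show "norm (f z - f (of_real (1 - 1 / (real n + 2)) * z)) \<le> e" if "norm z \<le> 1" for z
        using n[OF that] by (simp only: dist_norm norm_minus_commute less_imp_le)
    qed (auto simp: field_simps)
  qed
  fix r :: real assume r: "0 < r" "r < 1"
  have r1: "norm (of_real r * z) \<le> 1" if "norm z \<le> 1" for z :: complex
    using r that by (simp add: norm_mult mult_le_one)
  show "disk_norm (\<lambda>z. f (of_real r * z)) \<le> disk_norm f"
    by (rule disk_norm_le) (intro le r1)
  have cg: "continuous_on (cball 0 1) (\<lambda>z. f (of_real r * z))"
    by (rule continuous_on_dilate[OF holomorphic_on_imp_continuous_on[OF hf]]) (use r in auto)
  have hg: "(\<lambda>z. f (of_real r * z)) holomorphic_on ball 0 1"
    by (rule holomorphic_dilate[OF hf]) (use r in auto)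
  have cgs: "continuous_on (sphere 0 1) (\<lambda>z. f (of_real r * z))"
    by (rule continuous_on_subset[OF cg]) auto
  fix N R \<zeta> assume arc: "arc_points N R \<zeta>"
  have R: "0 < R" "R < 1" "0 < N" "\<And>j. j \<in> {1..N} \<Longrightarrow> \<zeta> j \<in> open_arc N j" using arc by (auto simp: arc_points_def)
  have mean: "circle_mean (\<lambda>w. norm (f (of_real r * w)) * norm (szego_kernel (of_real R * w) z) ^ i)
      \<le> disk_norm f * circle_mean (\<lambda>w. norm (szego_kernel (of_real R * w) z) ^ i)" if z: "norm z \<le> 1" for z i
  proof -
    have ck: "continuous_on (sphere 0 1) (\<lambda>w. norm (szego_kernel (of_real R * w) z) ^ i)"
      using R z by (intro continuous_on_power continuous_on_norm continuous_on_szego_kernel_parameter) auto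
    show ?thesis
      unfolding circle_mean_mult_left[symmetric]
      by (intro circle_mean_mono continuous_on_mult continuous_on_mult_left continuous_on_norm cgs ck mult_right_mono le r1)
        auto
  qed
  show "disk_norm (szego_sum N R \<zeta> (\<lambda>z. f (of_real r * z)) J) \<le> 2 * (1 + real n) * disk_norm f"
    if J: "J \<le> N" and n: "(1 / 2) ^ n \<le> 1 - R" for J n
  proof (rule disk_norm_le)
    fix z :: complex assume z: "norm z \<le> 1"
    have "norm (szego_sum N R \<zeta> (\<lambda>z. f (of_real r * z)) J z) \<le>
        2 * circle_mean (\<lambda>w. norm (f (of_real r * w)) * norm (szego_kernel (of_real R * w) z))"
      unfolding szego_sum_def by (rule szego_sum_bound[OF cgs R(1-3) arc_pointsD(1)[OF arc] R(4) z J])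
    also have "\<dots> \<le> 2 * (disk_norm f * circle_mean (\<lambda>w. norm (szego_kernel (of_real R * w) z)))"
      using mean[OF z, of 1] by simp
    also have "\<dots> \<le> 2 * (disk_norm f * (1 + real n))"
      using R z n nn by (intro mult_left_mono circle_mean_szego_parameter_le(2)[where R = R]) auto
    finally show "norm (szego_sum N R \<zeta> (\<lambda>z. f (of_real r * z)) J z) \<le> 2 * (1 + real n) * disk_norm f"
      by (simp add: mult_ac)
  qed
  show "disk_norm (\<lambda>z. szego_sum N R \<zeta> (\<lambda>z. f (of_real r * z)) N z - f (of_real r * (of_real R * z))) \<le> 1 / 2 * disk_norm f"
  proof (rule disk_norm_le)
    fix z :: complex assume z: "norm z \<le> 1"
    have "norm (szego_sum N R \<zeta> (\<lambda>z. f (of_real r * z)) N z - f (of_real r * (of_real R * z))) \<le>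
        6 * pi / real N * circle_mean (\<lambda>w. norm (f (of_real r * w)) * (norm (szego_kernel (of_real R * w) z))\<^sup>2)"
      unfolding szego_sum_def by (rule szego_sum_approx[OF cg hg R(1-3) arc_pointsD(1)[OF arc] R(4) z])
    also have "\<dots> \<le> 6 * pi / real N * (disk_norm f * circle_mean (\<lambda>w. (norm (szego_kernel (of_real R * w) z))\<^sup>2))"
      by (intro mult_left_mono mean z) auto
    also have "\<dots> \<le> 6 * pi / real N * (disk_norm f * (1 / (1 - R)))"
      using R z nn by (intro mult_left_mono circle_mean_szego_parameter_le(1)[where R = R]) auto
    also have "\<dots> = 6 * pi / real N * (1 / (1 - R)) * disk_norm f" by simp
    also have "\<dots> \<le> 1 / 2 * disk_norm f"
      by (rule mult_right_mono[OF arc_pointsD(2)[OF arc] nn])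
    finally show "norm (szego_sum N R \<zeta> (\<lambda>z. f (of_real r * z)) N z - f (of_real r * (of_real R * z))) \<le> 1 / 2 * disk_norm f" .
  qed
next
  fix f :: "complex \<Rightarrow> complex" and B :: real
  assume "continuous_on (cball 0 1) f" "f holomorphic_on ball 0 1"
  then show "f \<in> disk_algebra" by (simp add: disk_algebra_def)
  show "disk_norm f \<le> B" if "\<And>z. norm z \<le> 1 \<Longrightarrow> norm (f z) \<le> B"
    by (rule disk_norm_le[OF that])
qed

theorem theorem4p1:
  "\<exists>C :: real. C > 0 \<and>
     (\<forall>(R :: nat \<Rightarrow> real) (N :: nat \<Rightarrow> nat) (M :: nat \<Rightarrow> nat)
        (\<zeta> :: nat \<Rightarrow> nat \<Rightarrow> nat \<Rightarrow> complex).
        (\<forall>k\<ge>1. 0 < R k \<and> R k < 1) \<longrightarrow>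
        R \<longlonglongrightarrow> 1 \<longrightarrow>
        (\<forall>k\<ge>1. N k > 0 \<and> M k > 0) \<longrightarrow>
        (\<forall>k\<ge>1. \<forall>j\<in>{1..N k}. \<forall>l\<in>{1..M k}. \<zeta> k l j \<in> open_arc (N k) j) \<longrightarrow>
        (\<forall>k\<ge>1. \<forall>j\<in>{1..N k}. inj_on (\<lambda>l. \<zeta> k l j) {1..M k}) \<longrightarrow>
        (\<forall>k\<ge>1. real (N k) * (1 - R k) \<ge> C) \<longrightarrow>
        (\<lambda>k. ln (1 / (1 - R k))) \<in> O(\<lambda>k. real (M k)) \<longrightarrow>
        (let x = (\<lambda>n. case lex_enum N M n of (k, l, j) \<Rightarrow> szego_kernel (of_real (R k) * \<zeta> k l j))
         in representing_system H1_space H1_norm x \<and>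
            representing_system disk_algebra disk_norm x))"
\<comment> \<open>The value required in \<open>arc_points\<close>.\<close>
proof (intro exI[of _ "12 * pi"] conjI allI impI)
  show "0 < 12 * pi" by simp
  fix R :: "nat \<Rightarrow> real" and N M :: "nat \<Rightarrow> nat" and \<zeta> :: "nat \<Rightarrow> nat \<Rightarrow> nat \<Rightarrow> complex"
  assume hyps: "\<forall>k\<ge>1. 0 < R k \<and> R k < 1" "R \<longlonglongrightarrow> 1" "\<forall>k\<ge>1. N k > 0 \<and> M k > 0"
    "\<forall>k\<ge>1. \<forall>j\<in>{1..N k}. \<forall>l\<in>{1..M k}. \<zeta> k l j \<in> open_arc (N k) j"
    "\<forall>k\<ge>1. real (N k) * (1 - R k) \<ge> 12 * pi" "(\<lambda>k. ln (1 / (1 - R k))) \<in> O(\<lambda>k. real (M k))"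
  show "let x = (\<lambda>n. case lex_enum N M n of (k, l, j) \<Rightarrow> szego_kernel (of_real (R k) * \<zeta> k l j))
      in representing_system H1_space H1_norm x \<and> representing_system disk_algebra disk_norm x"
    unfolding Let_def
    by (intro conjI H1.representing_system_szego_kernels disk.representing_system_szego_kernels)
      (use hyps in auto)
qed

end
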